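(* For every integer $n\geq 1$, the word problem for the one relation Adian inverse semigroup given by the presentation $Inv\langle a,b\mid a=ba^nb\rangle$ is decidable.
   Context: Let $X=\{a,b\}$ and let $X^{-1}$ be a disjoint set of formal inverses. The Vagner congruence $\rho$ on the free monoid $(X\cup X^{-1})^*$ is the congruence whose quotient is the free inverse monoid on $X$. $Inv\langle X\mid R\rangle$ denotes $(X\cup X^{-1})^*/\tau$, where $\tau$ is the congruence generated by $R\cup\rho$; here $R=\{(a,ba^nb)\}$. The word problem is decidable if there is an algorithm which, given two words $u,v\in (X\cup X^{-1})^*$, decides whether $u$ and $v$ represent the same element of $Inv\langle X\mid R\rangle$. A presentation with relations $u_i=v_i$ between positive words is called Adian (cycle free) if neither its left graph nor its right graph contains a cycle; the left (right) graph has vertex set $X$ and, for every relation $(u_i,v_i)$, one undirected edge joining the first (last) letters of $u_i$ and $v_i$. *)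

theory Defs
  imports Main "HOL-Library.Nat_Bijection"
begin

section \<open>Inverse monoid presentations\<close>

datatype 'x letter = Pos 'x | Neg 'x

type_synonym 'x word = "'x letter list"

fun letter_inv :: "'x letter \<Rightarrow> 'x letter" where
  "letter_inv (Pos x) = Neg x"
| "letter_inv (Neg x) = Pos x"

definition word_inv :: "'x word \<Rightarrow> 'x word" where
  "word_inv w = rev (map letter_inv w)"

inductive_set congruence_generated :: "('c list \<times> 'c list) set \<Rightarrow> ('c list \<times> 'c list) set"
  for S :: "('c list \<times> 'c list) set" where
  base: "(u, v) \<in> S \<Longrightarrow> (u, v) \<in> congruence_generated S"
| refl: "(u, u) \<in> congruence_generated S"
| sym: "(u, v) \<in> congruence_generated S \<Longrightarrow> (v, u) \<in> congruence_generated S"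
| trans: "(u, v) \<in> congruence_generated S \<Longrightarrow> (v, w) \<in> congruence_generated S
    \<Longrightarrow> (u, w) \<in> congruence_generated S"
| mult: "(u, v) \<in> congruence_generated S \<Longrightarrow> (u', v') \<in> congruence_generated S
    \<Longrightarrow> (u @ u', v @ v') \<in> congruence_generated S"

definition vagner :: "('x word \<times> 'x word) set" where
  "vagner = congruence_generated
     ({(u @ word_inv u @ u, u) | u. True} \<union>
      {(u @ word_inv u @ v @ word_inv v, v @ word_inv v @ u @ word_inv u) | u v. True})"

text \<open>
  The relations of a presentation are pairs of positive words, i.e. of lists over the
  generators; \<open>map Pos\<close> embeds them into the words over generators and formal inverses.
\<close>

definition inv_congruence :: "('x list \<times> 'x list) set \<Rightarrow> ('x word \<times> 'x word) set" where
  "inv_congruence R =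
     congruence_generated ({(map Pos u, map Pos v) | u v. (u, v) \<in> R} \<union> vagner)"

text \<open>The underlying set of the inverse monoid \<open>Inv\<langle>X | R\<rangle>\<close>, and the element a word represents.\<close>

definition Inv :: "('x list \<times> 'x list) set \<Rightarrow> 'x word set set" where
  "Inv R = UNIV // inv_congruence R"

definition Inv_elem :: "('x list \<times> 'x list) set \<Rightarrow> 'x word \<Rightarrow> 'x word set" where
  "Inv_elem R w = inv_congruence R `` {w}"

lemma Inv_elem_in_Inv: "Inv_elem R w \<in> Inv R"
  by (simp add: Inv_def Inv_elem_def quotientI)

lemma Inv_elem_eq_iff: "Inv_elem R u = Inv_elem R v \<longleftrightarrow> (u, v) \<in> inv_congruence R"
  unfolding Inv_elem_def inv_congruence_def
  by (auto intro: congruence_generated.intros)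


section \<open>Adian presentations\<close>

text \<open>
  A multigraph is given by a set \<open>E\<close> of edges and a map \<open>ends\<close> sending each edge to its set of
  end points. Loops and pairs of parallel edges count as cycles.
\<close>

definition has_cycle :: "('e \<Rightarrow> 'v set) \<Rightarrow> 'e set \<Rightarrow> bool" where
  "has_cycle ends E \<longleftrightarrow>
     (\<exists>vs es. vs \<noteq> [] \<and> length es = length vs \<and> distinct vs \<and> distinct es \<and> set es \<subseteq> E \<and>
        (\<forall>i < length vs. ends (es ! i) = {vs ! i, vs ! (Suc i mod length vs)}))"

definition adian :: "('x list \<times> 'x list) set \<Rightarrow> bool" where
  "adian R \<longleftrightarrow> (\<forall>(u, v) \<in> R. u \<noteq> [] \<and> v \<noteq> []) \<and>
     \<not> has_cycle (\<lambda>(u, v). {hd u, hd v}) R \<and>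
     \<not> has_cycle (\<lambda>(u, v). {last u, last v}) R"


section \<open>Decidability\<close>

text \<open>
  The total recursive functions of arity \<open>k\<close>: the least class containing the initial functions
  and closed under composition, primitive recursion and minimisation of regular functions.
  Arguments are passed as a list; only the values on lists of length \<open>k\<close> are meaningful.
\<close>

inductive recursive_fun :: "nat \<Rightarrow> (nat list \<Rightarrow> nat) \<Rightarrow> bool" where
  zero: "recursive_fun k (\<lambda>xs. 0)"
| succ: "recursive_fun 1 (\<lambda>xs. Suc (hd xs))"
| proj: "i < k \<Longrightarrow> recursive_fun k (\<lambda>xs. xs ! i)"
| comp: "recursive_fun (length gs) f \<Longrightarrow> \<forall>g \<in> set gs. recursive_fun k g
    \<Longrightarrow> recursive_fun k (\<lambda>xs. f (map (\<lambda>g. g xs) gs))"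
| prim_rec: "recursive_fun k f \<Longrightarrow> recursive_fun (Suc (Suc k)) g
    \<Longrightarrow> recursive_fun (Suc k)
          (\<lambda>xs. rec_nat (f (tl xs)) (\<lambda>m r. g (m # r # tl xs)) (hd xs))"
| minim: "recursive_fun (Suc k) f \<Longrightarrow> \<forall>xs. length xs = k \<longrightarrow> (\<exists>y. f (y # xs) = 0)
    \<Longrightarrow> recursive_fun k (\<lambda>xs. LEAST y. f (y # xs) = 0)"

datatype gen = Gen_a | Gen_b

fun letter_code :: "gen letter \<Rightarrow> nat" where
  "letter_code (Pos Gen_a) = 0"
| "letter_code (Pos Gen_b) = 1"
| "letter_code (Neg Gen_a) = 2"
| "letter_code (Neg Gen_b) = 3"

definition word_code :: "gen word \<Rightarrow> nat" where
  "word_code w = list_encode (map letter_code w)"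

lemma inj_word_code: "inj word_code"
proof -
  have "inj letter_code"
  proof (rule injI)
    fix x y assume "letter_code x = letter_code y"
    then show "x = y"
      by (cases x rule: letter_code.cases; cases y rule: letter_code.cases) auto
  qed
  then have "inj (\<lambda>w. list_encode (map letter_code w))"
    by (auto simp: inj_def list_encode_eq inj_map_eq_map)
  then show ?thesis
    by (simp add: word_code_def[abs_def])
qed

text \<open>Decidability of a binary predicate on words; the decision function returns 1 for ``yes''.\<close>

definition decidable :: "(gen word \<Rightarrow> gen word \<Rightarrow> bool) \<Rightarrow> bool" where
  "decidable P \<longleftrightarrow>
     (\<exists>f. recursive_fun 2 f \<and>
        (\<forall>u v. f [word_code u, word_code v] = (if P u v then 1 else 0)))"

definition word_problem_decidable :: "(gen list \<times> gen list) set \<Rightarrow> bool" where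
  "word_problem_decidable R \<longleftrightarrow> decidable (\<lambda>u v. Inv_elem R u = Inv_elem R v)"


section \<open>The presentation \<open>a = b a\<^sup>n b\<close>\<close>

lemma adian_one_relation: "adian {([Gen_a], [Gen_b] @ replicate n Gen_a @ [Gen_b])}"
proof -
  have no_cycle: "\<not> has_cycle ends {e}" if "ends e = {Gen_a, Gen_b}"
    for ends :: "'e \<Rightarrow> gen set" and e
  proof
    assume "has_cycle ends {e}"
    then obtain vs es where c: "vs \<noteq> []" "length es = length vs" "distinct es" "set es \<subseteq> {e}"
        "\<forall>i < length vs. ends (es ! i) = {vs ! i, vs ! (Suc i mod length vs)}"
      unfolding has_cycle_def by blast
    have "length es = card (set es)"
      using c(3) by (simp add: distinct_card)
    also have "\<dots> \<le> 1"
      using card_mono[OF _ c(4)] by simp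
    finally have "length vs \<le> 1"
      using c(2) by simp
    then have len: "length vs = 1"
      using c(1) by (cases vs) auto
    have "es ! 0 \<in> set es"
      using len c(2) by (intro nth_mem) simp
    then have "es ! 0 = e"
      using c(4) by blast
    then show False
      using c(5) len that by (auto simp: doubleton_eq_iff)
  qed
  show ?thesis
    unfolding adian_def by (simp add: no_cycle insert_commute)
qed

end

theory Submission
  imports Defs Complex_Main
begin

text \<open>
  The group with the presentation \<open>a = b a\<^sup>n b\<close> is totally left ordered, with the nonempty
  positive words in \<open>a\<close> and \<open>b\<close> as positive cone. Therefore the Schuetzenberger graph of a word
  \<open>w\<close> is the full subgraph of the Cayley graph on an interval, and the element of the inverse
  monoid represented by \<open>w\<close> is determined by the value of \<open>w\<close> in the group together with the least
  and the greatest value of a prefix of \<open>w\<close>. The order is realised by an action on the real line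
  in which the stabiliser of \<open>0\<close> is trivial, so these three group elements are compared by exact
  rational arithmetic.

  The action comes from \<open>c = a\<^sup>n b\<close>, since the relation says \<open>a\<^sup>n\<^sup>+\<^sup>1 = c\<^sup>2\<close>: let \<open>a\<close> be the
  translation by \<open>2\<close> and \<open>c\<close> a square root of the translation by \<open>2n + 2\<close> with \<open>c 0 = 2n + 1\<close>.
  Then \<open>b 0 = c 0 - 2n = 1 > 0\<close>.
\<close>

section \<open>The action on the real line\<close>

text \<open>This is c, with period T. It exchanges the pieces [0, D) and [D, T) of a period, sending
  the second into the next period, with reciprocal slopes 1/D and D. These slopes keep the orbit of
  0 inside the rationals whose denominator is a power of D.\<close>

definition half_turn :: "nat \<Rightarrow> real \<Rightarrow> real" where
  "half_turn n x =
     (let T = 2 * real n + 2; D = 2 * real n + 1; q = of_int \<lfloor>x / T\<rfloor>; r = x - q * T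
      in q * T + (if r < D then D + r / D else T + D * (r - D)))"

text \<open>As c = a^n b, the letter b acts as c followed by the translation by -2n. The last clause
  inverts this, the inverse of c being c followed by the translation by -(2n + 2).\<close>

fun lact :: "nat \<Rightarrow> gen letter \<Rightarrow> real \<Rightarrow> real" where
  "lact n (Pos Gen_a) x = x + 2"
| "lact n (Neg Gen_a) x = x - 2"
| "lact n (Pos Gen_b) x = half_turn n x - 2 * real n"
| "lact n (Neg Gen_b) x = half_turn n (x + 2 * real n) - (2 * real n + 2)"

definition wact :: "nat \<Rightarrow> gen word \<Rightarrow> real \<Rightarrow> real" where
  "wact n w = foldr (lact n) w"

text \<open>This is the least value at 0 of a prefix: letters act increasingly, so the minimum
  passes through \<open>lact n l\<close>, and 0 is the value of the empty prefix.\<close>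

definition low :: "nat \<Rightarrow> gen word \<Rightarrow> real" where
  "low n w = foldr (\<lambda>l x. min 0 (lact n l x)) w 0"

definition high :: "nat \<Rightarrow> gen word \<Rightarrow> real" where
  "high n w = foldr (\<lambda>l x. max 0 (lact n l x)) w 0"

section \<open>A square root of the translation by the period\<close>

lemma half_turn_eq:
  assumes "0 \<le> r" "r < 2 * real n + 2"
  shows "half_turn n (of_int q * (2 * real n + 2) + r) = of_int q * (2 * real n + 2) +
    (if r < 2 * real n + 1 then 2 * real n + 1 + r / (2 * real n + 1)
     else 2 * real n + 2 + (2 * real n + 1) * (r - (2 * real n + 1)))"
proof -
  have "\<lfloor>(of_int q * (2 * real n + 2) + r) / (2 * real n + 2)\<rfloor> = q"
    using assms by (simp add: floor_eq_iff field_simps)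
  then show ?thesis by (simp add: half_turn_def Let_def)
qed

lemma turn_decomp:
  obtains q r where "x = of_int q * (2 * real n + 2) + r" "0 \<le> r" "r < 2 * real n + 2"
proof
  let ?q = "\<lfloor>x / (2 * real n + 2)\<rfloor>"
  have p: "2 * real n + 2 > 0" by simp
  have "of_int ?q \<le> x / (2 * real n + 2)" "x / (2 * real n + 2) < of_int ?q + 1" by linarith+
  then have "of_int ?q * (2 * real n + 2) \<le> x" "x < (of_int ?q + 1) * (2 * real n + 2)"
    by (simp_all only: pos_le_divide_eq[OF p] pos_divide_less_eq[OF p])
  then show "0 \<le> x - of_int ?q * (2 * real n + 2)" "x - of_int ?q * (2 * real n + 2) < 2 * real n + 2"
    by (simp_all add: algebra_simps)
qed simp

text \<open>The two pieces of a period are exchanged by affine maps with reciprocal slopes, which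
  cancel up to the passage to the next period.\<close>

lemma half_turn_half_turn: "half_turn n (half_turn n x) = x + (2 * real n + 2)"
proof -
  obtain q r where x: "x = of_int q * (2 * real n + 2) + r" and r: "0 \<le> r" "r < 2 * real n + 2"
    by (rule turn_decomp)
  define D where "D = 2 * real n + 1"
  have D: "D > 0" "2 * real n + 2 = D + 1" by (simp_all add: D_def)
  show ?thesis
  proof (cases "r < D")
    case True
    have s: "0 \<le> r / D" "r / D < 1" using r(1) True D(1) by simp_all
    have "half_turn n x = of_int q * (2 * real n + 2) + (D + r / D)"
      using half_turn_eq[OF r, of q] True by (simp add: x D_def)
    moreover have "half_turn n (of_int q * (2 * real n + 2) + (D + r / D)) =
        of_int q * (2 * real n + 2) + (2 * real n + 2 + D * (D + r / D - D))"
      using half_turn_eq[of "D + r / D" n q] s D(1) D(2)[symmetric] by (simp add: D_def add.commute)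
    ultimately show ?thesis using D(1) by (simp add: x D(2))
  next
    case False
    let ?s = "D * (r - D)"
    have "r - D < 1" using r(2) D(2) by simp
    then have s: "0 \<le> ?s" "?s < D" using False D(1) mult_strict_left_mono[of "r - D" 1 D] by simp_all
    have "half_turn n x = of_int (q + 1) * (2 * real n + 2) + ?s"
      using half_turn_eq[OF r, of q] False by (simp add: x D_def algebra_simps)
    moreover have "half_turn n (of_int (q + 1) * (2 * real n + 2) + ?s) =
        of_int (q + 1) * (2 * real n + 2) + (D + ?s / D)"
      using half_turn_eq[of ?s n "q + 1", folded D_def, unfolded D(2)] s D
      by (simp only: D(2)) simp
    moreover have "of_int (q + 1) * (2 * real n + 2) + (D + ?s / D) = x + (2 * real n + 2)"
      using D(1) unfolding x D(2) by (simp add: distrib_right)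
    ultimately show ?thesis by simp
  qed
qed

lemma half_turn_strict_mono:
  assumes "x < y"
  shows "half_turn n x < half_turn n y"
proof -
  obtain q r where x: "x = of_int q * (2 * real n + 2) + r" and r: "0 \<le> r" "r < 2 * real n + 2"
    by (rule turn_decomp)
  obtain p s where y: "y = of_int p * (2 * real n + 2) + s" and s: "0 \<le> s" "s < 2 * real n + 2"
    by (rule turn_decomp)
  define D where "D = 2 * real n + 1"
  have D: "D > 0" "2 * real n + 2 = D + 1" by (simp_all add: D_def)
  let ?h = "\<lambda>t. if t < D then D + t / D else D + 1 + D * (t - D)"
  have hx: "half_turn n x = of_int q * (D + 1) + ?h r"
    using half_turn_eq[OF r, of q] by (simp add: x D_def)
  have hy: "half_turn n y = of_int p * (D + 1) + ?h s"
    using half_turn_eq[OF s, of p] by (simp add: y D_def)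
  \<comment> \<open>A period is mapped into [D, D + 1 + D), whose length is one period, so the
    images of distinct periods do not overlap.\<close>
  have lower: "D \<le> ?h s" using s D by auto
  have "r / D < 1" if "r < D" using that D(1) by simp
  moreover have "D * (r - D) < D" using r D mult_strict_left_mono[of "r - D" 1 D] by simp
  ultimately have upper: "?h r < D + 1 + D" using D(1) by (cases "r < D") (simp_all add: add_strict_increasing)
  have "q \<le> p"
  proof (rule ccontr)
    assume "\<not> q \<le> p"
    then have "of_int (p + 1) * (D + 1) \<le> of_int q * (D + 1)"
      using D by (intro mult_right_mono) (simp_all only: of_int_le_iff)
    then show False using assms r s D(1) unfolding x y D(2) by (simp add: algebra_simps)
  qed
  show ?thesis
  proof (cases "q = p")
    case True
    then have "r < s" using assms by (simp add: x y)
    moreover have "r / D < 1" if "r < D" using that D(1) by simp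
    moreover have "r / D < 1 + D * (s - D)" if "r < D" "D \<le> s"
      using calculation(2) that D(1) mult_nonneg_nonneg[of D "s - D"] by linarith
    ultimately have "?h r < ?h s" using D(1)
      by (cases "r < D"; cases "s < D") (simp_all add: divide_strict_right_mono)
    then show ?thesis using True hx hy by simp
  next
    case False
    then have "of_int (q + 1) * (D + 1) \<le> of_int p * (D + 1)"
      using D \<open>q \<le> p\<close> by (intro mult_right_mono) (simp_all only: of_int_le_iff)
    then show ?thesis using lower upper hx hy by (simp add: algebra_simps)
  qed
qed

text \<open>Both sides are the third iterate of \<open>half_turn\<close> at
  \<open>x\<close>.\<close>

lemma half_turn_shift: "half_turn n (x + (2 * real n + 2)) = half_turn n x + (2 * real n + 2)"
  by (metis half_turn_half_turn)

lemma half_turn_shift_minus: "half_turn n (x - (2 * real n + 2)) = half_turn n x - (2 * real n + 2)"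
  using half_turn_shift[of n "x - (2 * real n + 2)"] by simp

lemma half_turn_0: "half_turn n 0 = 2 * real n + 1"
  using half_turn_eq[of 0 n 0] by simp

section \<open>Words as increasing maps and the extreme values of their prefixes\<close>

lemma lact_strict_mono: "x < y \<Longrightarrow> lact n l x < lact n l y"
  by (cases "(n, l, x)" rule: lact.cases) (auto intro: half_turn_strict_mono)

lemma lact_mono_iff: "lact n l x \<le> lact n l y \<longleftrightarrow> x \<le> y"
  by (metis lact_strict_mono linorder_not_le order_less_le)

lemma letter_inv_letter_inv [simp]: "letter_inv (letter_inv l) = l"
  by (cases l) auto

lemma lact_letter_inv [simp]: "lact n (letter_inv l) (lact n l x) = x"
  by (cases "(n, l, x)" rule: lact.cases)
     (simp_all add: half_turn_half_turn half_turn_shift_minus[simplified])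

lemma lact_letter_inv' [simp]: "lact n l (lact n (letter_inv l) x) = x"
  using lact_letter_inv[of n "letter_inv l" x] by simp

lemma lact_min: "lact n l (min x y) = min (lact n l x) (lact n l y)"
  by (simp add: min_def lact_mono_iff)

lemma lact_max: "lact n l (max x y) = max (lact n l x) (lact n l y)"
  by (simp add: max_def lact_mono_iff)

lemma word_inv_Nil [simp]: "word_inv [] = []"
  and word_inv_Cons: "word_inv (l # w) = word_inv w @ [letter_inv l]"
  and word_inv_append [simp]: "word_inv (u @ v) = word_inv v @ word_inv u"
  by (simp_all add: word_inv_def)

lemma word_inv_word_inv [simp]: "word_inv (word_inv w) = w"
  by (simp add: word_inv_def rev_map comp_def)

lemma wact_Nil [simp]: "wact n [] x = x"
  and wact_Cons [simp]: "wact n (l # w) x = lact n l (wact n w x)"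
  and wact_append [simp]: "wact n (u @ v) x = wact n u (wact n v x)"
  by (simp_all add: wact_def)

lemma low_Nil [simp]: "low n [] = 0"
  and low_Cons [simp]: "low n (l # w) = min 0 (lact n l (low n w))"
  and high_Nil [simp]: "high n [] = 0"
  and high_Cons [simp]: "high n (l # w) = max 0 (lact n l (high n w))"
  by (simp_all add: low_def high_def)

lemma wact_mono_iff: "wact n w x \<le> wact n w y \<longleftrightarrow> x \<le> y"
  by (induction w) (simp_all add: lact_mono_iff)

lemma wact_eq_iff [simp]: "wact n w x = wact n w y \<longleftrightarrow> x = y"
  by (metis wact_mono_iff order_antisym order_refl)

lemma wact_word_inv [simp]: "wact n (word_inv w) (wact n w x) = x"
  by (induction w arbitrary: x) (simp_all add: word_inv_Cons)

lemma wact_word_inv' [simp]: "wact n w (wact n (word_inv w) x) = x"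
  using wact_word_inv[of n "word_inv w" x] by simp

lemma wact_min: "wact n w (min x y) = min (wact n w x) (wact n w y)"
  and wact_max: "wact n w (max x y) = max (wact n w x) (wact n w y)"
  by (simp_all add: min_def max_def wact_mono_iff)

lemma low_le: "low n w \<le> 0" "low n w \<le> wact n w 0"
proof -
  show "low n w \<le> 0" by (cases w) auto
  show "low n w \<le> wact n w 0" by (induction w) (auto simp: lact_mono_iff min_le_iff_disj)
qed

lemma high_ge: "0 \<le> high n w" "wact n w 0 \<le> high n w"
proof -
  show "0 \<le> high n w" by (cases w) auto
  show "wact n w 0 \<le> high n w" by (induction w) (auto simp: lact_mono_iff le_max_iff_disj)
qed

lemma low_append: "low n (u @ v) = min (low n u) (wact n u (low n v))"
  using low_le(1)[of n v] by (induction u) (auto simp: lact_min min.assoc min_absorb2)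

lemma high_append: "high n (u @ v) = max (high n u) (wact n u (high n v))"
  using high_ge(1)[of n v] by (induction u) (auto simp: lact_max max.assoc max_absorb2)

text \<open>In the group, \<open>w\<close> times a prefix of its inverse is a prefix of
  \<open>w\<close>, and every prefix of \<open>w\<close> arises so.\<close>

lemma wact_low_word_inv: "wact n w (low n (word_inv w)) = low n w"
proof (induction w)
  case (Cons l w)
  have "low n (word_inv (l # w)) = min (low n (word_inv w)) (wact n (word_inv w) (min 0 (lact n (letter_inv l) 0)))"
    by (simp add: word_inv_Cons low_append)
  also have "wact n (l # w) \<dots> = min (lact n l (low n w)) (lact n l (min 0 (lact n (letter_inv l) 0)))"
    using Cons by (simp add: wact_min lact_min)
  also have "\<dots> = min 0 (lact n l (low n w))"
    using lact_mono_iff[of n l "low n w" 0] low_le(1)[of n w] by (simp only: lact_min lact_letter_inv', linarith)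
  finally show ?case by simp
qed simp

lemma wact_high_word_inv: "wact n w (high n (word_inv w)) = high n w"
proof (induction w)
  case (Cons l w)
  have "high n (word_inv (l # w)) = max (high n (word_inv w)) (wact n (word_inv w) (max 0 (lact n (letter_inv l) 0)))"
    by (simp add: word_inv_Cons high_append)
  also have "wact n (l # w) \<dots> = max (lact n l (high n w)) (lact n l (max 0 (lact n (letter_inv l) 0)))"
    using Cons by (simp add: wact_max lact_max)
  also have "\<dots> = max 0 (lact n l (high n w))"
    using lact_mono_iff[of n l 0 "high n w"] high_ge(1)[of n w] by (simp only: lact_max lact_letter_inv', linarith)
  finally show ?case by simp
qed simp

lemma low_idempotent: "low n (w @ word_inv w) = low n w"
  and high_idempotent: "high n (w @ word_inv w) = high n w"
  by (simp_all add: low_append high_append wact_low_word_inv wact_high_word_inv)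

section \<open>Invariance under the congruence\<close>

text \<open>The actions are to agree at every point, not only at 0, because the extreme values of
  \<open>u @ v\<close> involve the action of \<open>u\<close> at an extreme value of
  \<open>v\<close>; this makes the relation compatible with products.\<close>

definition same_range :: "nat \<Rightarrow> gen word \<Rightarrow> gen word \<Rightarrow> bool" where
  "same_range n u v \<longleftrightarrow> (\<forall>x. wact n u x = wact n v x) \<and> low n u = low n v \<and> high n u = high n v"

lemma same_range_generated:
  assumes "(u, v) \<in> congruence_generated S" and "\<And>u v. (u, v) \<in> S \<Longrightarrow> same_range n u v"
  shows "same_range n u v"
  using assms(1)
proof induction
  case (base u v)
  then show ?case by (rule assms(2))
qed (simp_all add: same_range_def low_append high_append)

lemma same_range_vagner:
  assumes "(u, v) \<in> vagner"
  shows "same_range n u v"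
  using assms unfolding vagner_def
proof (rule same_range_generated)
  fix u v :: "gen word"
  assume "(u, v) \<in> {(u @ word_inv u @ u, u) | u. True} \<union>
      {(u @ word_inv u @ v @ word_inv v, v @ word_inv v @ u @ word_inv u) | u v. True}"
  then consider "u = v @ word_inv v @ v"
    | x y where "u = (x @ word_inv x) @ y @ word_inv y" "v = (y @ word_inv y) @ x @ word_inv x"
    by auto
  then show "same_range n u v"
  proof cases
    case 1
    then show ?thesis
      by (simp add: same_range_def low_append high_append wact_min wact_max wact_low_word_inv
          wact_high_word_inv)
  next
    case 2
    then show ?thesis
      by (simp add: same_range_def low_append[of _ "_ @ _"] high_append[of _ "_ @ _"]
          low_idempotent high_idempotent min.commute max.commute del: append_assoc)
  qed
qed

section \<open>Positive words move 0 to the right\<close>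

lemma lact_Pos_0: "0 < lact n (Pos g) 0"
  \<comment> \<open>The letter a moves 0 to 2, and b moves it to (2n + 1) - 2n = 1.\<close>
  by (cases g) (simp_all add: half_turn_0)

lemma positive_wact: "0 \<le> wact n (map Pos p) 0" "wact n (map Pos p) 0 = 0 \<longleftrightarrow> p = []"
proof -
  have "0 < wact n (map Pos p) 0" if "p \<noteq> []" for p
    using that
  proof (induction p)
    case (Cons g p)
    have "0 \<le> wact n (map Pos p) 0" using Cons(1) by (cases "p = []") auto
    then have "lact n (Pos g) 0 \<le> lact n (Pos g) (wact n (map Pos p) 0)" by (simp add: lact_mono_iff)
    then show ?case using lact_Pos_0[of n g] by simp
  qed simp
  from this[of p] show "0 \<le> wact n (map Pos p) 0" "wact n (map Pos p) 0 = 0 \<longleftrightarrow> p = []"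
    by (cases "p = []"; force)+
qed

lemma low_positive: "low n (map Pos p) = 0"
proof (induction p)
  case (Cons g p)
  then show ?case using lact_Pos_0[of n g] by simp
qed simp

lemma high_positive: "high n (map Pos p) = wact n (map Pos p) 0"
proof (induction p)
  case (Cons g p)
  then show ?case using positive_wact(1)[of n "g # p"] by simp
qed simp

definition relations :: "nat \<Rightarrow> (gen list \<times> gen list) set" where
  "relations n = {([Gen_a], [Gen_b] @ replicate n Gen_a @ [Gen_b])}"

lemma wact_replicate_a: "wact n (replicate k (Pos Gen_a)) x = x + 2 * real k"
  by (induction k) simp_all

lemma same_range_relation:
  "same_range n (map Pos [Gen_a]) (map Pos ([Gen_b] @ replicate n Gen_a @ [Gen_b]))"
proof -
  \<comment> \<open>In b a^n b the translations by -2n and 2n between the two copies of c cancel,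
    leaving c^2 followed by -2n, the translation by 2.\<close>
  have "wact n (map Pos [Gen_a]) x = wact n (map Pos ([Gen_b] @ replicate n Gen_a @ [Gen_b])) x" for x
    by (simp add: wact_replicate_a half_turn_half_turn)
  then show ?thesis
    unfolding same_range_def using low_positive high_positive by metis
qed

theorem same_range_if_congruent:
  assumes "(u, v) \<in> inv_congruence (relations n)"
  shows "same_range n u v"
  using assms unfolding inv_congruence_def
  by (rule same_range_generated) (use same_range_vagner same_range_relation in \<open>auto simp: relations_def\<close>)

section \<open>Divisibility of positive words\<close>

text \<open>The congruence of the monoid, not the inverse monoid, presented by a = b a^n b. The aim
  is that left and right divisibility are total in it.\<close>

definition pos_eq :: "gen list \<Rightarrow> nat \<Rightarrow> gen list \<Rightarrow> bool" ("(_ \<sim>\<^bsub>_\<^esub> _)" [51, 0, 51] 50) where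
  "p \<sim>\<^bsub>n\<^esub> q \<longleftrightarrow> (p, q) \<in> congruence_generated (relations n)"

abbreviation as :: "nat \<Rightarrow> gen list" where
  "as k \<equiv> replicate k Gen_a"

lemma pos_eq_refl [simp, intro]: "p \<sim>\<^bsub>n\<^esub> p"
  and pos_eq_sym: "p \<sim>\<^bsub>n\<^esub> q \<Longrightarrow> q \<sim>\<^bsub>n\<^esub> p"
  and pos_eq_trans [trans]: "p \<sim>\<^bsub>n\<^esub> q \<Longrightarrow> q \<sim>\<^bsub>n\<^esub> r \<Longrightarrow> p \<sim>\<^bsub>n\<^esub> r"
  and pos_eq_append: "p \<sim>\<^bsub>n\<^esub> p' \<Longrightarrow> q \<sim>\<^bsub>n\<^esub> q' \<Longrightarrow> p @ q \<sim>\<^bsub>n\<^esub> p' @ q'"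
  and pos_eq_relation: "[Gen_a] \<sim>\<^bsub>n\<^esub> Gen_b # as n @ [Gen_b]"
  unfolding pos_eq_def
  by (auto intro: congruence_generated.intros simp: relations_def)

lemma pos_eq_context: "p \<sim>\<^bsub>n\<^esub> q \<Longrightarrow> u @ p @ v \<sim>\<^bsub>n\<^esub> u @ q @ v"
  by (simp add: pos_eq_append)

lemma replicate_append_Cons: "replicate k x @ x # xs = x # replicate k x @ xs"
  by (induction k) simp_all

lemma pos_eq_relation_context: "u @ Gen_a # v \<sim>\<^bsub>n\<^esub> u @ Gen_b # as n @ Gen_b # v"
  using pos_eq_context[OF pos_eq_relation, where u = u and v = v] by simp

text \<open>Both sides of the relation are palindromes. Reversal exchanges left and right
  divisibility.\<close>

lemma pos_eq_rev:
  assumes "p \<sim>\<^bsub>n\<^esub> q"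
  shows "rev p \<sim>\<^bsub>n\<^esub> rev q"
  using assms unfolding pos_eq_def
  by induction (auto simp: relations_def intro: congruence_generated.intros)

lemma Inv_elem_pos_eq:
  assumes "p \<sim>\<^bsub>n\<^esub> q"
  shows "Inv_elem (relations n) (map Pos p) = Inv_elem (relations n) (map Pos q)"
proof -
  let ?S = "{(map Pos u, map Pos v) |u v. (u, v) \<in> relations n} \<union> vagner"
  have "(map Pos p, map Pos q) \<in> congruence_generated ?S"
    using assms unfolding pos_eq_def
  proof induction
    case (base u v)
    then show ?case by (intro congruence_generated.base) auto
  next
    case (refl u)
    show ?case by (rule congruence_generated.refl)
  next
    case (sym u v)
    show ?case by (rule congruence_generated.sym[OF sym.IH])
  next
    case (trans u v w)
    show ?case by (rule congruence_generated.trans[OF trans.IH])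
  next
    case (mult u v u' v')
    show ?case using congruence_generated.mult[OF mult.IH] by simp
  qed
  then show ?thesis by (simp add: Inv_elem_eq_iff inv_congruence_def)
qed

text \<open>Expanding the last a of b a^(n+1) gives b a^n b a^n b, whose first b a^n b contracts to
  a. Hence a^(n+1) is central.\<close>

lemma pos_eq_central: "Gen_b # as (Suc n) @ v \<sim>\<^bsub>n\<^esub> as (Suc n) @ Gen_b # v"
proof -
  have "Gen_b # as (Suc n) @ v = (Gen_b # as n) @ Gen_a # v"
    by (simp add: replicate_append_Cons)
  also have "\<dots> \<sim>\<^bsub>n\<^esub> (Gen_b # as n) @ Gen_b # as n @ Gen_b # v"
    by (rule pos_eq_relation_context)
  also have "\<dots> = [] @ Gen_b # as n @ Gen_b # (as n @ Gen_b # v)" by simp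
  also have "\<dots> \<sim>\<^bsub>n\<^esub> [] @ Gen_a # (as n @ Gen_b # v)"
    by (rule pos_eq_sym, rule pos_eq_relation_context)
  finally show ?thesis by simp
qed

text \<open>The factors \<open>s\<close> of the normal forms \<open>a\<^sup>k s\<close> of the rewriting system \<open>b a\<^sup>n b \<rightarrow> a\<close>, \<open>b a\<^sup>n\<^sup>+\<^sup>1 \<rightarrow> a\<^sup>n\<^sup>+\<^sup>1 b\<close>.\<close>

inductive_set reduced :: "nat \<Rightarrow> gen list set" for n where
  Nil: "[] \<in> reduced n"
| step: "i < n \<Longrightarrow> s \<in> reduced n \<Longrightarrow> Gen_b # as i @ s \<in> reduced n"
| last: "Gen_b # as n \<in> reduced n"

text \<open>Strong induction on \<open>k\<close>: for \<open>k < n\<close> the word is reduced, for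
  \<open>k = n\<close> a following b contracts with b a^n, and for larger \<open>k\<close> the
  central factor a^(n+1) moves to the front.\<close>

lemma b_times_normal_form:
  assumes "s \<in> reduced n"
  shows "\<exists>j t. t \<in> reduced n \<and> Gen_b # as k @ s \<sim>\<^bsub>n\<^esub> as j @ t"
proof (induction k rule: less_induct)
  case (less k)
  consider "k < n" | "k = n" | "k > n" by linarith
  then show ?case
  proof cases
    case 1
    then have "Gen_b # as k @ s \<sim>\<^bsub>n\<^esub> as 0 @ (Gen_b # as k @ s)" "Gen_b # as k @ s \<in> reduced n"
      using assms by (auto intro: reduced.step)
    then show ?thesis by blast
  next
    case 2
    have fold: "Gen_b # as n @ Gen_b # v \<sim>\<^bsub>n\<^esub> Gen_a # v" for v
      using pos_eq_relation_context[where u = "[]" and v = v] by (auto intro: pos_eq_sym)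
    from assms show ?thesis
    proof cases
      case Nil
      then have "Gen_b # as k @ s \<sim>\<^bsub>n\<^esub> as 0 @ (Gen_b # as n)" using 2 by simp
      then show ?thesis using reduced.last by blast
    next
      case (step i t)
      then have "Gen_b # as k @ s \<sim>\<^bsub>n\<^esub> as (Suc i) @ t" using 2 fold[of "as i @ t"] by simp
      then show ?thesis using step by blast
    next
      case last
      then have "Gen_b # as k @ s \<sim>\<^bsub>n\<^esub> as (Suc n) @ []" using 2 fold[of "as n"] by simp
      then show ?thesis using reduced.Nil by blast
    qed
  next
    case 3
    define m where "m = k - Suc n"
    have "k = Suc n + m" using 3 by (simp add: m_def)
    then have k: "as k = as (Suc n) @ as m" by (simp only: replicate_add)
    obtain j t where t: "t \<in> reduced n" "Gen_b # as m @ s \<sim>\<^bsub>n\<^esub> as j @ t"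
      using less[of m] 3 by (auto simp: m_def)
    have "Gen_b # as k @ s \<sim>\<^bsub>n\<^esub> as (Suc n) @ Gen_b # as m @ s"
      using pos_eq_central[where v = "as m @ s"] by (simp add: k)
    also have "\<dots> \<sim>\<^bsub>n\<^esub> as (Suc n) @ as j @ t" using t(2) by (intro pos_eq_append pos_eq_refl)
    also have "\<dots> = as (Suc n + j) @ t" by (simp only: replicate_add append_assoc)
    finally show ?thesis using t(1) by blast
  qed
qed

lemma normal_form: "\<exists>k t. t \<in> reduced n \<and> s \<sim>\<^bsub>n\<^esub> as k @ t"
proof (induction s)
  case Nil
  have "[] \<sim>\<^bsub>n\<^esub> as 0 @ []" by simp
  then show ?case using reduced.Nil by blast
next
  case (Cons y s)
  then obtain k t where t: "t \<in> reduced n" "s \<sim>\<^bsub>n\<^esub> as k @ t" by blast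
  have ys: "y # s \<sim>\<^bsub>n\<^esub> y # as k @ t" using pos_eq_append[OF pos_eq_refl t(2), where p = "[y]"] by simp
  show ?case
  proof (cases y)
    case Gen_a
    then have "y # s \<sim>\<^bsub>n\<^esub> as (Suc k) @ t" using ys by simp
    then show ?thesis using t(1) by blast
  next
    case Gen_b
    then show ?thesis using b_times_normal_form[OF t(1), of k] ys by (blast intro: pos_eq_trans)
  qed
qed

text \<open>As \<open>i < n\<close>, the word b a^n b has a further a right after b a^i. By
  induction this a is a multiple of \<open>s\<close>, which turns b a^i s into a left
  divisor.\<close>

lemma reduced_divides_a: "s \<in> reduced n \<Longrightarrow> \<exists>t. [Gen_a] \<sim>\<^bsub>n\<^esub> s @ t"
proof (induction rule: reduced.induct)
  case Nil
  show ?case by (auto intro: exI[of _ "[Gen_a]"])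
next
  case (step i s)
  then obtain t where t: "[Gen_a] \<sim>\<^bsub>n\<^esub> s @ t" by blast
  have n: "as n = as i @ [Gen_a] @ as (n - Suc i)"
    using step(1) by (simp add: replicate_append_Cons flip: replicate_Suc replicate_add)
  have "[Gen_a] \<sim>\<^bsub>n\<^esub> (Gen_b # as i) @ [Gen_a] @ as (n - Suc i) @ [Gen_b]"
    using pos_eq_relation[where n = n] by (subst (asm) n) simp
  also have "\<dots> \<sim>\<^bsub>n\<^esub> (Gen_b # as i) @ (s @ t) @ as (n - Suc i) @ [Gen_b]"
    by (rule pos_eq_context[OF t])
  finally show ?case by (intro exI[of _ "t @ as (n - Suc i) @ [Gen_b]"]) simp
next
  case last
  show ?case using pos_eq_relation by (auto intro: exI[of _ "[Gen_b]"])
qed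

text \<open>A normal form a^k r starts with a unless k = 0, and then r divides a. Every nonempty
  word starts with b, up to a = b a^n b.\<close>

lemma letter_comparable: "\<exists>t. [y] \<sim>\<^bsub>n\<^esub> s @ t \<or> s \<sim>\<^bsub>n\<^esub> y # t"
proof (cases y)
  case Gen_a
  obtain k r where r: "r \<in> reduced n" "s \<sim>\<^bsub>n\<^esub> as k @ r" using normal_form by blast
  show ?thesis
  proof (cases k)
    case 0
    obtain t where "[Gen_a] \<sim>\<^bsub>n\<^esub> r @ t" using reduced_divides_a[OF r(1)] by blast
    moreover have "r @ t \<sim>\<^bsub>n\<^esub> s @ t"
      using pos_eq_append[OF pos_eq_sym[OF r(2)] pos_eq_refl, where q = t] 0 by simp
    ultimately have "[y] \<sim>\<^bsub>n\<^esub> s @ t" using Gen_a pos_eq_trans by blast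
    then show ?thesis by blast
  next
    case (Suc m)
    then have "s \<sim>\<^bsub>n\<^esub> y # as m @ r" using r(2) Gen_a by simp
    then show ?thesis by blast
  qed
next
  case Gen_b
  show ?thesis
  proof (cases s)
    case Nil
    then have "[y] \<sim>\<^bsub>n\<^esub> s @ [y]" by simp
    then show ?thesis by blast
  next
    case (Cons x p)
    have "Gen_a # p \<sim>\<^bsub>n\<^esub> y # as n @ Gen_b # p"
      using pos_eq_relation_context[where u = "[]" and v = p] Gen_b by simp
    moreover have "Gen_b # p \<sim>\<^bsub>n\<^esub> y # p" using Gen_b by simp
    ultimately show ?thesis using Cons by (cases x) blast+
  qed
qed

text \<open>When \<open>p\<close> is a multiple \<open>q @ t\<close>, the letter appended to
  \<open>q\<close> is compared with the remaining factor \<open>t\<close>.\<close>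

lemma left_comparable: "\<exists>t. q \<sim>\<^bsub>n\<^esub> p @ t \<or> p \<sim>\<^bsub>n\<^esub> q @ t"
proof (induction q rule: rev_induct)
  case Nil
  show ?case by (auto intro: exI[of _ p])
next
  case (snoc y q)
  then obtain t where "q \<sim>\<^bsub>n\<^esub> p @ t \<or> p \<sim>\<^bsub>n\<^esub> q @ t" by blast
  then show ?case
  proof
    assume q: "q \<sim>\<^bsub>n\<^esub> p @ t"
    then have "q @ [y] \<sim>\<^bsub>n\<^esub> p @ (t @ [y])"
      using pos_eq_append[OF q pos_eq_refl, where q = "[y]"] by simp
    then show ?thesis by blast
  next
    assume p: "p \<sim>\<^bsub>n\<^esub> q @ t"
    obtain s where "[y] \<sim>\<^bsub>n\<^esub> t @ s \<or> t \<sim>\<^bsub>n\<^esub> y # s" using letter_comparable by blast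
    then show ?thesis
    proof
      assume "[y] \<sim>\<^bsub>n\<^esub> t @ s"
      then have "q @ [y] \<sim>\<^bsub>n\<^esub> q @ t @ s" by (intro pos_eq_append pos_eq_refl)
      also have "\<dots> \<sim>\<^bsub>n\<^esub> p @ s"
        using pos_eq_append[OF pos_eq_sym[OF p] pos_eq_refl, where q = s] by simp
      finally show ?thesis by blast
    next
      assume "t \<sim>\<^bsub>n\<^esub> y # s"
      then have "q @ t \<sim>\<^bsub>n\<^esub> q @ y # s" by (intro pos_eq_append pos_eq_refl)
      then have "p \<sim>\<^bsub>n\<^esub> (q @ [y]) @ s" using p by (auto intro: pos_eq_trans)
      then show ?thesis by blast
    qed
  qed
qed

lemma right_comparable: "\<exists>t. q \<sim>\<^bsub>n\<^esub> t @ p \<or> p \<sim>\<^bsub>n\<^esub> t @ q"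
proof -
  obtain t where "rev q \<sim>\<^bsub>n\<^esub> rev p @ t \<or> rev p \<sim>\<^bsub>n\<^esub> rev q @ t" using left_comparable by blast
  then have "q \<sim>\<^bsub>n\<^esub> rev t @ p \<or> p \<sim>\<^bsub>n\<^esub> rev t @ q"
    using pos_eq_rev[where p = "rev q"] pos_eq_rev[where p = "rev p"] by fastforce
  then show ?thesis by blast
qed

section \<open>Words as intervals\<close>

lemma Inv_elem_append:
  "Inv_elem R u = Inv_elem R u' \<Longrightarrow> Inv_elem R v = Inv_elem R v' \<Longrightarrow>
    Inv_elem R (u @ v) = Inv_elem R (u' @ v')"
  unfolding Inv_elem_eq_iff inv_congruence_def by (rule congruence_generated.mult)

lemma Inv_elem_context:
  "Inv_elem R u = Inv_elem R v \<Longrightarrow> Inv_elem R (x @ u @ y) = Inv_elem R (x @ v @ y)"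
  by (rule Inv_elem_append[OF HOL.refl Inv_elem_append[OF _ HOL.refl]])

lemma Inv_elem_vagner: "(u, v) \<in> vagner \<Longrightarrow> Inv_elem R u = Inv_elem R v"
  unfolding Inv_elem_eq_iff inv_congruence_def by (blast intro: congruence_generated.base)

lemma Inv_elem_cancel: "Inv_elem R (x @ u @ word_inv u @ u @ y) = Inv_elem R (x @ u @ y)"
proof -
  have "(u @ word_inv u @ u, u) \<in> vagner"
    unfolding vagner_def by (rule congruence_generated.base) auto
  from Inv_elem_context[OF Inv_elem_vagner[OF this], of R x y] show ?thesis by simp
qed

lemma Inv_elem_commute:
  "Inv_elem R (x @ u @ word_inv u @ v @ word_inv v @ y) =
   Inv_elem R (x @ v @ word_inv v @ u @ word_inv u @ y)"
proof -
  have "(u @ word_inv u @ v @ word_inv v, v @ word_inv v @ u @ word_inv u) \<in> vagner"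
    unfolding vagner_def by (rule congruence_generated.base) auto
  from Inv_elem_context[OF Inv_elem_vagner[OF this], of R x y] show ?thesis by simp
qed

text \<open>Uniqueness of inverses: as idempotents commute, both sides equal v^(-1) u
  u^(-1).\<close>

lemma Inv_elem_word_inv:
  assumes "Inv_elem R u = Inv_elem R v"
  shows "Inv_elem R (word_inv u) = Inv_elem R (word_inv v)"
proof -
  let ?u = "word_inv u" and ?v = "word_inv v" and ?E = "Inv_elem R"
  have uv: "?E (x @ u @ y) = ?E (x @ v @ y)" for x y by (rule Inv_elem_context[OF assms])
  have "?E ?u = ?E (?u @ u @ ?u)" using Inv_elem_cancel[of R "[]" ?u "[]"] by simp
  also have "\<dots> = ?E (?u @ v @ ?u)" by (rule uv)
  also have "\<dots> = ?E (?u @ v @ ?v @ v @ ?u)" using Inv_elem_cancel[of R ?u v ?u] by simp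
  also have "\<dots> = ?E (?u @ u @ ?v @ v @ ?u)" by (rule uv[symmetric])
  also have "\<dots> = ?E (?v @ v @ ?u @ u @ ?u)"
    using Inv_elem_commute[of R "[]" ?u ?v ?u] by simp
  also have "\<dots> = ?E (?v @ v @ ?u)" using Inv_elem_cancel[of R "?v @ v" ?u "[]"] by simp
  also have "\<dots> = ?E (?v @ u @ ?u)" by (rule uv[symmetric])
  finally have 1: "?E ?u = ?E (?v @ u @ ?u)" .
  have "?E ?v = ?E (?v @ v @ ?v)" using Inv_elem_cancel[of R "[]" ?v "[]"] by simp
  also have "\<dots> = ?E (?v @ u @ ?v)" by (rule uv[symmetric])
  also have "\<dots> = ?E (?v @ u @ ?u @ u @ ?v)" using Inv_elem_cancel[of R ?v u ?v] by simp
  also have "\<dots> = ?E (?v @ u @ ?u @ v @ ?v)" using uv[of "?v @ u @ ?u" ?v] by simp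
  also have "\<dots> = ?E (?v @ v @ ?v @ u @ ?u)"
    using Inv_elem_commute[of R ?v u v "[]"] by simp
  also have "\<dots> = ?E (?v @ u @ ?u)" using Inv_elem_cancel[of R "[]" ?v "u @ ?u"] by simp
  finally show ?thesis using 1 by simp
qed

text \<open>The hypothesis says that l^(-1) labels a path from the initial vertex of the
  Schuetzenberger graph of \<open>w\<close>. Prepending y^(-1) moves the initial vertex, and y^(-1)
  l^(-1) becomes readable from there.\<close>

lemma stab_prepend_inverse:
  assumes "Inv_elem R w = Inv_elem R (word_inv l @ l @ w)"
  shows "Inv_elem R (word_inv y @ w) = Inv_elem R (word_inv (l @ y) @ (l @ y) @ word_inv y @ w)"
proof -
  let ?E = "Inv_elem R"
  have "?E (word_inv y @ w) = ?E (word_inv y @ word_inv l @ l @ w)"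
    using Inv_elem_context[OF assms, of "word_inv y" "[]"] by simp
  also have "\<dots> = ?E (word_inv y @ y @ word_inv y @ word_inv l @ l @ w)"
    using Inv_elem_cancel[of R "[]" "word_inv y" "word_inv l @ l @ w"] by simp
  also have "\<dots> = ?E (word_inv y @ word_inv l @ l @ y @ word_inv y @ w)"
    using Inv_elem_commute[of R "word_inv y" y "word_inv l" w] by simp
  finally show ?thesis by simp
qed

text \<open>From the new initial vertex, y leads to the old one, and l^(-1) = y^(-1) s^(-1) returns
  before it reads s^(-1).\<close>

lemma stab_prepend:
  assumes "Inv_elem R w = Inv_elem R (word_inv l @ l @ w)" and l: "Inv_elem R l = Inv_elem R (s @ y)"
  shows "Inv_elem R (y @ w) = Inv_elem R (word_inv s @ s @ y @ w)"
proof -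
  let ?E = "Inv_elem R"
  have "?E (y @ w) = ?E (y @ word_inv l @ l @ w)"
    using Inv_elem_context[OF assms(1), of y "[]"] by simp
  also have "\<dots> = ?E (y @ word_inv (s @ y) @ l @ w)"
    using Inv_elem_context[OF Inv_elem_word_inv[OF l], of y "l @ w"] by simp
  also have "\<dots> = ?E (y @ word_inv (s @ y) @ (s @ y) @ w)"
    using Inv_elem_context[OF l, of "y @ word_inv (s @ y)" w] by simp
  also have "\<dots> = ?E (word_inv s @ s @ y @ word_inv y @ y @ w)"
    using Inv_elem_commute[of R "[]" y "word_inv s" "y @ w"] by simp
  also have "\<dots> = ?E (word_inv s @ s @ y @ w)"
    using Inv_elem_cancel[of R "word_inv s @ s" y w] by simp
  finally show ?thesis .
qed

text \<open>The factor r r^(-1) makes the whole path r available. It passes through s and then y, so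
  the detour y y^(-1) at the end of s lies on it and can be cut.\<close>

lemma interval_absorb:
  assumes r: "Inv_elem R r = Inv_elem R (s @ y @ t)"
  shows "Inv_elem R (r @ word_inv r @ s @ y @ word_inv y @ w) = Inv_elem R (r @ word_inv r @ s @ w)"
proof -
  let ?E = "Inv_elem R"
  let ?k = "y @ t @ word_inv t @ word_inv y"
  have *: "?E (r @ word_inv r @ s @ x) = ?E (s @ ?k @ x)" for x
  proof -
    have "?E (r @ word_inv r @ s @ x) = ?E ((s @ y @ t) @ word_inv r @ s @ x)"
      using Inv_elem_context[OF r, of "[]" "word_inv r @ s @ x"] by simp
    also have "\<dots> = ?E ((s @ y @ t) @ word_inv (s @ y @ t) @ s @ x)"
      using Inv_elem_context[OF Inv_elem_word_inv[OF r], of "s @ y @ t" "s @ x"] by simp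
    also have "\<dots> = ?E (s @ word_inv s @ s @ ?k @ x)"
      using Inv_elem_commute[of R s "y @ t" "word_inv s" x] by simp
    also have "\<dots> = ?E (s @ ?k @ x)" using Inv_elem_cancel[of R "[]" s "?k @ x"] by simp
    finally show ?thesis .
  qed
  have "?E (r @ word_inv r @ s @ y @ word_inv y @ w) = ?E (s @ ?k @ y @ word_inv y @ w)"
    using *[of "y @ word_inv y @ w"] by simp
  also have "\<dots> = ?E (s @ ?k @ w)"
    using Inv_elem_cancel[of R "s @ y @ t @ word_inv t" "word_inv y" w] by simp
  finally show ?thesis using *[of w] by simp
qed

abbreviation elem :: "nat \<Rightarrow> gen word \<Rightarrow> gen word set" where
  "elem n \<equiv> Inv_elem (relations n)"

abbreviation pos :: "gen list \<Rightarrow> gen word" where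
  "pos \<equiv> map Pos"

section \<open>The order on the line and divisibility\<close>

lemma wact_cong: "elem n u = elem n v \<Longrightarrow> wact n u x = wact n v x"
  using same_range_if_congruent[of u v n] by (simp add: Inv_elem_eq_iff same_range_def)

lemma wact_inverse_positive: "wact n (word_inv (pos p)) 0 \<le> 0"
  using wact_mono_iff[of n "pos p" "wact n (word_inv (pos p)) 0" 0] positive_wact(1)[of n p] by simp

lemma wact_inverse_positive_eq: "wact n (word_inv (pos p)) 0 = 0 \<longleftrightarrow> p = []"
  using wact_eq_iff[of n "pos p" "wact n (word_inv (pos p)) 0" 0] positive_wact(2)[of n p] by auto

text \<open>Divisibility is total; if it holds the other way round, the order of the values forces
  the quotient to be empty.\<close>

lemma left_divides:
  assumes "wact n (pos p) 0 \<le> wact n (pos q) 0"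
  obtains t where "elem n (pos q) = elem n (pos p @ pos t)"
proof -
  obtain t where "q \<sim>\<^bsub>n\<^esub> p @ t \<or> p \<sim>\<^bsub>n\<^esub> q @ t"
    using left_comparable[where p = p and q = q and n = n] by blast
  then have "elem n (pos q) = elem n (pos p @ pos t) \<or> elem n (pos p) = elem n (pos q @ pos t)"
    by (metis Inv_elem_pos_eq map_append)
  then show thesis
  proof
    assume *: "elem n (pos p) = elem n (pos q @ pos t)"
    then have "wact n (pos q) (wact n (pos t) 0) \<le> wact n (pos q) 0"
      using assms wact_cong[OF *, of 0] by simp
    then have "t = []" using positive_wact[of n t] by (simp add: wact_mono_iff)
    then show thesis using * that[of "[]"] by simp
  qed (rule that)
qed

text \<open>Right divisibility shows in the inverses: \<open>t @ p\<close> has the inverse p^(-1)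
  t^(-1), whose value at 0 is at most that of p^(-1).\<close>

lemma right_divides:
  assumes "wact n (word_inv (pos q)) 0 \<le> wact n (word_inv (pos p)) 0"
  obtains t where "elem n (pos q) = elem n (pos t @ pos p)"
proof -
  obtain t where "q \<sim>\<^bsub>n\<^esub> t @ p \<or> p \<sim>\<^bsub>n\<^esub> t @ q"
    using right_comparable[where p = p and q = q and n = n] by blast
  then have "elem n (pos q) = elem n (pos t @ pos p) \<or> elem n (pos p) = elem n (pos t @ pos q)"
    by (metis Inv_elem_pos_eq map_append)
  then show thesis
  proof
    assume *: "elem n (pos p) = elem n (pos t @ pos q)"
    then have "wact n (word_inv (pos q)) 0 \<le> wact n (word_inv (pos q)) (wact n (word_inv (pos t)) 0)"
      using assms wact_cong[OF Inv_elem_word_inv[OF *], of 0] by simp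
    then have "t = []"
      using wact_inverse_positive[of n t] wact_inverse_positive_eq[of n t] by (simp add: wact_mono_iff)
    then show thesis using * that[of "[]"] by simp
  qed (rule that)
qed

text \<open>The quotient given by \<open>left_divides\<close> fixes 0 and is therefore
  empty.\<close>

lemma positive_unique:
  assumes "wact n (pos p) 0 = wact n (pos q) 0"
  shows "elem n (pos p) = elem n (pos q)"
proof -
  have "wact n (pos p) 0 \<le> wact n (pos q) 0" using assms by simp
  then obtain t where t: "elem n (pos q) = elem n (pos p @ pos t)" by (rule left_divides)
  have "wact n (pos p) (wact n (pos t) 0) = wact n (pos p) 0"
    by (metis assms wact_cong[OF t] wact_append)
  then have "t = []" by (simp add: positive_wact)
  then show ?thesis using t by simp
qed

lemma positive_unique_inverse:
  assumes "wact n (word_inv (pos p)) 0 = wact n (word_inv (pos q)) 0"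
  shows "elem n (pos p) = elem n (pos q)"
proof -
  have "wact n (word_inv (pos q)) 0 \<le> wact n (word_inv (pos p)) 0" using assms by simp
  then obtain t where t: "elem n (pos q) = elem n (pos t @ pos p)" by (rule right_divides)
  have "wact n (word_inv (pos p)) (wact n (word_inv (pos t)) 0) = wact n (word_inv (pos p)) 0"
    by (metis assms wact_cong[OF Inv_elem_word_inv[OF t]] wact_append word_inv_append)
  then have "t = []" by (simp add: wact_inverse_positive_eq)
  then show ?thesis using t by simp
qed

section \<open>The ends of the interval and the walk inside it\<close>

text \<open>The least prefix value is reached from the initial vertex by a path of inverse letters
  only. A leading inverse letter extends this path; a leading positive letter is cancelled from it,
  or makes it empty.\<close>

lemma low_word:
  "\<exists>l. elem n w = elem n (word_inv (pos l) @ pos l @ w) \<and> wact n (word_inv (pos l)) 0 = low n w"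
proof (induction w)
  case Nil
  show ?case by (auto intro: exI[of _ "[]"])
next
  case (Cons x w)
  then obtain l where l: "elem n w = elem n (word_inv (pos l) @ pos l @ w)"
      "wact n (word_inv (pos l)) 0 = low n w" by blast
  show ?case
  proof (cases x)
    case (Neg y)
    have "lact n x (low n w) \<le> lact n x 0" "lact n x 0 \<le> 0"
      using low_le(1)[of n w] wact_inverse_positive[of n "[y]"]
      by (simp_all add: lact_mono_iff Neg word_inv_Cons)
    then have "low n (x # w) = wact n (word_inv (pos (l @ [y]))) 0"
      using l(2) by (simp add: Neg word_inv_Cons min_def)
    moreover have "elem n (x # w) = elem n (word_inv (pos (l @ [y])) @ pos (l @ [y]) @ x # w)"
      using stab_prepend_inverse[OF l(1), of "pos [y]"] by (simp add: Neg word_inv_Cons)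
    ultimately show ?thesis by metis
  next
    case (Pos y)
    show ?thesis
    proof (cases "0 \<le> lact n x (low n w)")
      case True
      then show ?thesis by (auto intro: exI[of _ "[]"])
    next
      case False
      \<comment> \<open>The image under y being negative means l^(-1) 0 < y^(-1) 0, so y divides l
        on the right.\<close>
      have "wact n (word_inv (pos l)) 0 \<le> wact n (word_inv (pos [y])) 0"
        using False l(2) wact_mono_iff[of n "pos [y]" "low n w" "wact n (word_inv (pos [y])) 0"]
          lact_letter_inv'[of n "Pos y", simplified] by (simp add: Pos word_inv_Cons)
      then obtain s where s: "elem n (pos l) = elem n (pos s @ pos [y])" by (rule right_divides)
      have "low n w = wact n (word_inv (pos s @ pos [y])) 0"
        using l(2) wact_cong[OF Inv_elem_word_inv[OF s], of 0] by simp
      then have "lact n x (low n w) = wact n (word_inv (pos s)) 0"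
        by (simp add: Pos word_inv_Cons lact_letter_inv'[of n "Pos y", simplified])
      then show ?thesis
        using False stab_prepend[OF l(1) s] by (intro exI[of _ s]) (simp add: Pos)
    qed
  qed
qed

text \<open>Mirror image of \<open>low_word\<close>: the two stability lemmas are applied to r^(-1)
  in place of l.\<close>

lemma high_word:
  "\<exists>r. elem n w = elem n (pos r @ word_inv (pos r) @ w) \<and> wact n (pos r) 0 = high n w"
proof (induction w)
  case Nil
  show ?case by (auto intro: exI[of _ "[]"])
next
  case (Cons x w)
  then obtain r where r: "elem n w = elem n (pos r @ word_inv (pos r) @ w)"
      "wact n (pos r) 0 = high n w" by blast
  show ?case
  proof (cases x)
    case (Pos y)
    have "lact n x 0 \<le> lact n x (high n w)" "0 \<le> lact n x 0"
      using high_ge(1)[of n w] positive_wact(1)[of n "[y]"] by (simp_all add: lact_mono_iff Pos)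
    then have "high n (x # w) = wact n (pos (y # r)) 0"
      using r(2) by (simp add: Pos max_def)
    moreover have "elem n (x # w) = elem n (pos (y # r) @ word_inv (pos (y # r)) @ x # w)"
      using stab_prepend_inverse[of "relations n" w "word_inv (pos r)" "word_inv (pos [y])"] r(1)
      by (simp add: Pos word_inv_Cons)
    ultimately show ?thesis by metis
  next
    case (Neg y)
    show ?thesis
    proof (cases "lact n x (high n w) \<le> 0")
      case True
      then show ?thesis by (auto intro: exI[of _ "[]"])
    next
      case False
      have "wact n (pos [y]) 0 \<le> wact n (pos r) 0"
        using False r(2) wact_mono_iff[of n "word_inv (pos [y])" "high n w" "wact n (pos [y]) 0"]
        by (simp add: Neg word_inv_Cons lact_letter_inv[of n "Pos y", simplified])
      then obtain s where s: "elem n (pos r) = elem n (pos [y] @ pos s)" by (rule left_divides)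
      have "lact n x (high n w) = wact n (pos s) 0"
        using r(2) wact_cong[OF s, of 0] lact_letter_inv[of n "Pos y", simplified] by (simp add: Neg flip: r(2))
      then show ?thesis
        using False r(1) stab_prepend[of "relations n" w "word_inv (pos r)" "word_inv (pos s)" "word_inv (pos [y])"]
          Inv_elem_word_inv[OF s]
        by (intro exI[of _ s]) (simp add: Neg word_inv_Cons)
    qed
  qed
qed

text \<open>The position is kept as a positive word \<open>t\<close>. A positive letter is appended.
  An inverse letter is cancelled at the right end of \<open>t\<close>, which the lower bound makes
  possible; r r^(-1) absorbs the cancelled pair because \<open>t\<close> divides
  \<open>r\<close>.\<close>

lemma walk_in_interval:
  assumes "\<And>k. 0 \<le> wact n (pos t @ take k w) 0 \<and> wact n (pos t @ take k w) 0 \<le> wact n (pos r) 0"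
  shows "\<exists>s. elem n (pos r @ word_inv (pos r) @ pos t @ w) = elem n (pos r @ word_inv (pos r) @ pos s) \<and>
    wact n (pos s) 0 = wact n (pos t @ w) 0"
  using assms
proof (induction w arbitrary: t)
  case Nil
  show ?case by auto
next
  case (Cons x w)
  show ?case
  proof (cases x)
    case (Pos y)
    have "0 \<le> wact n (pos (t @ [y]) @ take k w) 0 \<and>
        wact n (pos (t @ [y]) @ take k w) 0 \<le> wact n (pos r) 0" for k
      using Cons.prems[of "Suc k"] Pos by simp
    from Cons.IH[OF this] show ?thesis by (simp add: Pos)
  next
    case (Neg y)
    have "0 \<le> wact n (pos t) (wact n (word_inv (pos [y])) 0)"
      using Cons.prems[of 1] Neg by (simp add: word_inv_Cons)
    then have "wact n (word_inv (pos t)) 0 \<le> wact n (word_inv (pos [y])) 0"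
      using wact_mono_iff[of n "pos t" "wact n (word_inv (pos t)) 0" "wact n (word_inv (pos [y])) 0"]
      by simp
    then obtain s where s: "elem n (pos t) = elem n (pos s @ pos [y])" by (rule right_divides)
    have "wact n (pos t) 0 \<le> wact n (pos r) 0" using Cons.prems[of 0] by simp
    then obtain d where d: "elem n (pos r) = elem n (pos t @ pos d)" by (rule left_divides)
    have r: "elem n (pos r) = elem n (pos s @ pos [y] @ pos d)"
      using d Inv_elem_append[OF s HOL.refl, of "pos d"] by simp
    have ts: "wact n (pos t @ x # p) z = wact n (pos s @ p) z" for p z
      using wact_cong[OF s, of "wact n (x # p) z"] lact_letter_inv'[of n "Pos y", simplified]
      by (simp add: Neg)
    have "0 \<le> wact n (pos s @ take k w) 0 \<and> wact n (pos s @ take k w) 0 \<le> wact n (pos r) 0" for k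
      using Cons.prems[of "Suc k"] ts by simp
    from Cons.IH[OF this] obtain s' where s':
      "elem n (pos r @ word_inv (pos r) @ pos s @ w) = elem n (pos r @ word_inv (pos r) @ pos s')"
      "wact n (pos s') 0 = wact n (pos s @ w) 0" by blast
    have "elem n (pos r @ word_inv (pos r) @ pos t @ x # w) =
        elem n (pos r @ word_inv (pos r) @ pos s @ pos [y] @ word_inv (pos [y]) @ w)"
      using Inv_elem_context[OF s, of "pos r @ word_inv (pos r)" "x # w"] by (simp add: Neg word_inv_Cons)
    also have "\<dots> = elem n (pos r @ word_inv (pos r) @ pos s @ w)"
      by (rule interval_absorb[OF r])
    finally show ?thesis using s' ts by metis
  qed
qed

lemma low_le_prefix: "low n w \<le> wact n (take k w) 0"
  using low_append[of n "take k w" "drop k w"] low_le(2)[of n "take k w"] by simp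

lemma prefix_le_high: "wact n (take k w) 0 \<le> high n w"
  using high_append[of n "take k w" "drop k w"] high_ge(2)[of n "take k w"] by simp

text \<open>Prepending \<open>l\<close> translates the range of \<open>w\<close> to the interval
  from 0 to the value of \<open>l @ r\<close>. The walk along \<open>w\<close> from \<open>l\<close>
  stays there and is replaced by a positive word.\<close>

lemma interval_normal_form:
  obtains l r s where
    "elem n w = elem n (word_inv (pos l) @ pos (l @ r) @ word_inv (pos (l @ r)) @ pos s)"
    "wact n (word_inv (pos l)) 0 = low n w" "wact n (pos r) 0 = high n w"
    "wact n (pos s) 0 = wact n (pos l @ w) 0"
proof -
  obtain l where l: "elem n w = elem n (word_inv (pos l) @ pos l @ w)"
      "wact n (word_inv (pos l)) 0 = low n w" using low_word by blast
  obtain r where r: "elem n w = elem n (pos r @ word_inv (pos r) @ w)"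
      "wact n (pos r) 0 = high n w" using high_word by blast
  have "wact n (pos l) (low n w) = 0" by (simp flip: l(2))
  then have "0 \<le> wact n (pos l @ take k w) 0 \<and>
      wact n (pos l @ take k w) 0 \<le> wact n (pos (l @ r)) 0" for k
    using low_le_prefix[of n w k] prefix_le_high[of n k w]
      wact_mono_iff[of n "pos l" "low n w" "wact n (take k w) 0"] r(2) by (simp add: wact_mono_iff)
  from walk_in_interval[OF this] obtain s where s:
    "elem n (pos (l @ r) @ word_inv (pos (l @ r)) @ pos l @ w) =
     elem n (pos (l @ r) @ word_inv (pos (l @ r)) @ pos s)"
    "wact n (pos s) 0 = wact n (pos l @ w) 0" by blast
  have "elem n (pos l @ w) = elem n (pos (l @ r) @ word_inv (pos (l @ r)) @ pos l @ w)"
    using stab_prepend_inverse[of "relations n" w "word_inv (pos r)" "word_inv (pos l)"] r(1) by simp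
  then have "elem n (pos l @ w) = elem n (pos (l @ r) @ word_inv (pos (l @ r)) @ pos s)"
    using s(1) by simp
  then have "elem n w = elem n (word_inv (pos l) @ pos (l @ r) @ word_inv (pos (l @ r)) @ pos s)"
    using l(1) Inv_elem_append[OF HOL.refl, of "relations n" "pos l @ w" _ "word_inv (pos l)"] by simp
  then show thesis using that l(2) r(2) s(2) by blast
qed

text \<open>Conversely, the three values determine the positive words l, r and s of the interval
  normal form up to congruence.\<close>

theorem congruent_iff:
  "elem n u = elem n v \<longleftrightarrow> wact n u 0 = wact n v 0 \<and> low n u = low n v \<and> high n u = high n v"
proof
  assume "elem n u = elem n v"
  then show "wact n u 0 = wact n v 0 \<and> low n u = low n v \<and> high n u = high n v"
    using same_range_if_congruent[of u v n] by (simp add: Inv_elem_eq_iff same_range_def)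
next
  assume eq: "wact n u 0 = wact n v 0 \<and> low n u = low n v \<and> high n u = high n v"
  obtain l r s where u:
    "elem n u = elem n (word_inv (pos l) @ pos (l @ r) @ word_inv (pos (l @ r)) @ pos s)"
    "wact n (word_inv (pos l)) 0 = low n u" "wact n (pos r) 0 = high n u"
    "wact n (pos s) 0 = wact n (pos l @ u) 0" by (rule interval_normal_form)
  obtain l' r' s' where v:
    "elem n v = elem n (word_inv (pos l') @ pos (l' @ r') @ word_inv (pos (l' @ r')) @ pos s')"
    "wact n (word_inv (pos l')) 0 = low n v" "wact n (pos r') 0 = high n v"
    "wact n (pos s') 0 = wact n (pos l' @ v) 0" by (rule interval_normal_form)
  have l: "elem n (pos l) = elem n (pos l')" using u(2) v(2) eq by (simp add: positive_unique_inverse)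
  have r: "elem n (pos r) = elem n (pos r')" using u(3) v(3) eq by (simp add: positive_unique)
  have "wact n (pos s) 0 = wact n (pos s') 0"
    using u(4) v(4) eq wact_cong[OF l] by simp
  then have s: "elem n (pos s) = elem n (pos s')" by (rule positive_unique)
  have lr: "elem n (pos (l @ r)) = elem n (pos (l' @ r'))"
    using Inv_elem_append[OF l r] by simp
  show "elem n u = elem n v"
    unfolding u(1) v(1) by (intro Inv_elem_append Inv_elem_word_inv l lr s)
qed

section \<open>Recursive functions\<close>

text \<open>Working up to agreement on lists of length \<open>k\<close> allows functions to be
  rewritten as ordinary arithmetic expressions.\<close>

definition computable :: "nat \<Rightarrow> (nat list \<Rightarrow> nat) \<Rightarrow> bool" where
  "computable k f \<longleftrightarrow> (\<exists>g. recursive_fun k g \<and> (\<forall>xs. length xs = k \<longrightarrow> g xs = f xs))"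

lemma computable_recursive: "recursive_fun k f \<Longrightarrow> computable k f"
  unfolding computable_def by blast

lemma computable_cong:
  "computable k f \<Longrightarrow> (\<And>xs. length xs = k \<Longrightarrow> f xs = g xs) \<Longrightarrow> computable k g"
  unfolding computable_def by metis

lemma computable_comp:
  assumes "computable (length gs) f" "\<forall>g \<in> set gs. computable k g"
  shows "computable k (\<lambda>xs. f (map (\<lambda>g. g xs) gs))"
proof -
  obtain f' where f': "recursive_fun (length gs) f'" "\<forall>xs. length xs = length gs \<longrightarrow> f' xs = f xs"
    using assms(1) unfolding computable_def by blast
  obtain G where G: "\<forall>g \<in> set gs. recursive_fun k (G g) \<and> (\<forall>xs. length xs = k \<longrightarrow> G g xs = g xs)"
    using assms(2) unfolding computable_def by metis
  have "recursive_fun k (\<lambda>xs. f' (map (\<lambda>g. g xs) (map G gs)))"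
    by (rule recursive_fun.comp) (use f' G in auto)
  moreover have "f' (map (\<lambda>g. g xs) (map G gs)) = f (map (\<lambda>g. g xs) gs)" if "length xs = k" for xs
    using f'(2) G that by (auto intro!: arg_cong[of _ _ f])
  ultimately show ?thesis unfolding computable_def by blast
qed

lemma computable_comp1:
  assumes "computable 1 (\<lambda>xs. f (xs ! 0))" "computable k g"
  shows "computable k (\<lambda>xs. f (g xs))"
  using computable_comp[of "[g]" "\<lambda>xs. f (xs ! 0)" k] assms by simp

lemma computable_comp2:
  assumes "computable 2 (\<lambda>xs. f (xs ! 0) (xs ! 1))" "computable k g" "computable k h"
  shows "computable k (\<lambda>xs. f (g xs) (h xs))"
  using computable_comp[of "[g, h]" "\<lambda>xs. f (xs ! 0) (xs ! 1)" k] assms by (simp add: numeral_2_eq_2)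

lemma computable_nth: "i < k \<Longrightarrow> computable k (\<lambda>xs. xs ! i)"
  by (intro computable_recursive recursive_fun.proj)

lemma computable_drop_nth:
  assumes "i + 2 < k"
  shows "computable k (\<lambda>xs. drop 2 xs ! i)"
proof (rule computable_cong)
  show "computable k (\<lambda>xs. xs ! (i + 2))" using assms by (rule computable_nth)
qed (use assms in \<open>simp add: add.commute\<close>)

lemma computable_drop:
  assumes "computable k f"
  shows "computable (Suc (Suc k)) (\<lambda>xs. f (drop 2 xs))"
proof (rule computable_cong)
  let ?gs = "map (\<lambda>i xs. xs ! (i + 2)) [0..<k]"
  show "computable (Suc (Suc k)) (\<lambda>xs. f (map (\<lambda>g. g xs) ?gs))"
    by (rule computable_comp) (use assms in \<open>auto intro!: computable_nth\<close>)
  show "f (map (\<lambda>g. g xs) ?gs) = f (drop 2 xs)" if "length xs = Suc (Suc k)" for xs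
    using that by (intro arg_cong[of _ _ f] nth_equalityI) (simp_all add: add.commute)
qed

lemma computable_Suc:
  assumes "computable k f"
  shows "computable k (\<lambda>xs. Suc (f xs))"
proof (rule computable_comp1[OF _ assms])
  show "computable 1 (\<lambda>xs. Suc (xs ! 0))"
    by (rule computable_cong[OF computable_recursive[OF recursive_fun.succ]]) (auto simp: length_Suc_conv)
qed

lemma computable_const: "computable k (\<lambda>xs. c)"
  by (induction c) (auto intro: computable_Suc computable_recursive recursive_fun.zero)

text \<open>The step function receives the counter, the previous value and then the parameters,
  hence \<open>drop 2\<close>.\<close>

lemma computable_rec:
  assumes c: "computable k c" and b: "computable k b"
    and s: "computable (Suc (Suc k)) (\<lambda>ys. s (ys ! 0) (ys ! 1) (drop 2 ys))"
  shows "computable k (\<lambda>xs. rec_nat (b xs) (\<lambda>m r. s m r xs) (c xs))"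
proof -
  obtain b' where b': "recursive_fun k b'" "\<forall>xs. length xs = k \<longrightarrow> b' xs = b xs"
    using b unfolding computable_def by blast
  obtain s' where s': "recursive_fun (Suc (Suc k)) s'"
      "\<forall>ys. length ys = Suc (Suc k) \<longrightarrow> s' ys = s (ys ! 0) (ys ! 1) (drop 2 ys)"
    using s unfolding computable_def by blast
  let ?f = "\<lambda>ys. rec_nat (b' (tl ys)) (\<lambda>m r. s' (m # r # tl ys)) (hd ys)"
  let ?gs = "c # map (\<lambda>i xs. xs ! i) [0..<k]"
  show ?thesis
  proof (rule computable_cong)
    show "computable k (\<lambda>xs. ?f (map (\<lambda>g. g xs) ?gs))"
      by (rule computable_comp)
        (use recursive_fun.prim_rec[OF b'(1) s'(1)] c
          in \<open>auto intro: computable_recursive computable_nth\<close>)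
    show "?f (map (\<lambda>g. g xs) ?gs) = rec_nat (b xs) (\<lambda>m r. s m r xs) (c xs)" if "length xs = k" for xs
    proof -
      have "map (\<lambda>g. g xs) ?gs = c xs # xs"
        using that map_nth[of xs] by (simp add: comp_def)
      then show ?thesis using b'(2) s'(2) that by simp
    qed
  qed
qed

lemma computable_least:
  assumes f: "computable (Suc k) (\<lambda>ys. f (hd ys) (tl ys))"
    and regular: "\<And>xs. length xs = k \<Longrightarrow> \<exists>y. f y xs = 0"
  shows "computable k (\<lambda>xs. LEAST y. f y xs = 0)"
proof -
  obtain g where g: "recursive_fun (Suc k) g" "\<forall>ys. length ys = Suc k \<longrightarrow> g ys = f (hd ys) (tl ys)"
    using f unfolding computable_def by blast
  have "recursive_fun k (\<lambda>xs. LEAST y. g (y # xs) = 0)"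
    by (rule recursive_fun.minim) (use g regular in auto)
  then show ?thesis
    by (rule computable_cong[OF computable_recursive]) (use g(2) in simp)
qed

section \<open>Arithmetic and case distinctions\<close>

lemma computable_add:
  assumes "computable k f" "computable k g"
  shows "computable k (\<lambda>xs. f xs + g xs)"
proof (rule computable_comp2[OF _ assms])
  have "computable 2 (\<lambda>xs. rec_nat (xs ! 0) (\<lambda>m r. Suc r) (xs ! 1))"
    by (rule computable_rec) (auto intro!: computable_Suc computable_nth)
  moreover have "rec_nat x (\<lambda>m r. Suc r) y = x + y" for x y :: nat by (induction y) simp_all
  ultimately show "computable 2 (\<lambda>xs. xs ! 0 + xs ! 1)" by simp
qed

lemma computable_mult:
  assumes "computable k f" "computable k g"
  shows "computable k (\<lambda>xs. f xs * g xs)"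
proof (rule computable_comp2[OF _ assms])
  have "computable 2 (\<lambda>xs. rec_nat 0 (\<lambda>m r. r + xs ! 0) (xs ! 1))"
    by (rule computable_rec) (auto intro!: computable_add computable_nth computable_drop_nth computable_const)
  moreover have "rec_nat 0 (\<lambda>m r. r + x) y = x * y" for x y :: nat by (induction y) simp_all
  ultimately show "computable 2 (\<lambda>xs. xs ! 0 * xs ! 1)" by simp
qed

lemma computable_power:
  assumes "computable k f" "computable k g"
  shows "computable k (\<lambda>xs. f xs ^ g xs)"
proof (rule computable_comp2[OF _ assms])
  have "computable 2 (\<lambda>xs. rec_nat 1 (\<lambda>m r. r * xs ! 0) (xs ! 1))"
    by (rule computable_rec) (auto intro!: computable_mult computable_nth computable_drop_nth computable_const)
  moreover have "rec_nat 1 (\<lambda>m r. r * x) y = x ^ y" for x y :: nat by (induction y) simp_all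
  ultimately show "computable 2 (\<lambda>xs. xs ! 0 ^ xs ! 1)" by simp
qed

lemma computable_diff:
  assumes "computable k f" "computable k g"
  shows "computable k (\<lambda>xs. f xs - g xs)"
proof (rule computable_comp2[OF _ assms])
  have pred: "computable k (\<lambda>xs. h xs - 1)" if "computable k h" for k h
  proof (rule computable_comp1[OF _ that])
    have "computable 1 (\<lambda>xs. rec_nat 0 (\<lambda>m r. m) (xs ! 0))"
      by (rule computable_rec) (auto intro!: computable_nth computable_const)
    moreover have "rec_nat 0 (\<lambda>m r. m) y = y - 1" for y :: nat by (cases y) simp_all
    ultimately show "computable 1 (\<lambda>xs. xs ! 0 - 1)" by simp
  qed
  have "computable 2 (\<lambda>xs. rec_nat (xs ! 0) (\<lambda>m r. r - 1) (xs ! 1))"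
    by (rule computable_rec) (auto intro!: pred[simplified] computable_nth)
  moreover have "rec_nat x (\<lambda>m r. r - 1) y = x - y" for x y :: nat by (induction y) simp_all
  ultimately show "computable 2 (\<lambda>xs. xs ! 0 - xs ! 1)" by simp
qed

lemma computable_if_0:
  assumes "computable k f" "computable k g" "computable k h"
  shows "computable k (\<lambda>xs. if f xs = 0 then g xs else h xs)"
proof (rule computable_cong)
  show "computable k (\<lambda>xs. rec_nat (g xs) (\<lambda>m r. h xs) (f xs))"
    by (rule computable_rec) (use assms in \<open>auto intro: computable_drop\<close>)
  show "rec_nat (g xs) (\<lambda>m r. h xs) (f xs) = (if f xs = 0 then g xs else h xs)" for xs
    by (cases "f xs") simp_all
qed

lemma computable_if_less:
  assumes "computable k e" "computable k f" "computable k g" "computable k h"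
  shows "computable k (\<lambda>xs. if e xs < f xs then g xs else h xs)"
proof (rule computable_cong)
  show "computable k (\<lambda>xs. if Suc (e xs) - f xs = 0 then g xs else h xs)"
    using assms by (intro computable_if_0 computable_diff computable_Suc)
qed auto

lemma computable_if_eq:
  assumes "computable k e" "computable k f" "computable k g" "computable k h"
  shows "computable k (\<lambda>xs. if e xs = f xs then g xs else h xs)"
proof (rule computable_cong)
  show "computable k (\<lambda>xs. if (e xs - f xs) + (f xs - e xs) = 0 then g xs else h xs)"
    using assms by (intro computable_if_0 computable_diff computable_add)
qed auto

lemma computable_div:
  assumes "computable k f" "computable k g"
  shows "computable k (\<lambda>xs. f xs div g xs)"
proof (rule computable_comp2[OF _ assms])
  \<comment> \<open>The quotient is the least q with x < (q + 1) y. For divisor 0 the guard keeps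
    the search total and yields the value 0.\<close>
  let ?h = "\<lambda>q xs. if xs ! 1 = 0 then 0 else Suc (xs ! 0) - Suc q * xs ! 1"
  have "computable 2 (\<lambda>xs. LEAST q. ?h q xs = 0)"
  proof (rule computable_least)
    show "computable (Suc 2) (\<lambda>ys. ?h (hd ys) (tl ys))"
    proof (rule computable_cong)
      show "computable (Suc 2) (\<lambda>ys. if ys ! 2 = 0 then 0 else Suc (ys ! 1) - Suc (ys ! 0) * ys ! 2)"
        by (intro computable_if_0 computable_diff computable_mult computable_Suc computable_nth
            computable_const) simp_all
      show "(if ys ! 2 = 0 then 0 else Suc (ys ! 1) - Suc (ys ! 0) * ys ! 2) = ?h (hd ys) (tl ys)"
        if "length ys = Suc 2" for ys :: "nat list"
        using that by (cases ys) (auto simp: numeral_2_eq_2)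
    qed
    show "\<exists>q. ?h q xs = 0" for xs
      by (rule exI[of _ "xs ! 0"]) (cases "xs ! 1"; simp)
  qed
  moreover have "(LEAST q. (if y = 0 then 0 else Suc x - Suc q * y) = 0) = x div y" for x y :: nat
  proof (rule Least_equality)
    show "(if y = 0 then 0 else Suc x - Suc (x div y) * y) = 0"
      using dividend_less_div_times[of y x] by (simp add: Suc_le_eq add.commute)
    show "x div y \<le> q" if "(if y = 0 then 0 else Suc x - Suc q * y) = 0" for q
      using that less_mult_imp_div_less[of x "Suc q" y] by (auto split: if_splits)
  qed
  ultimately show "computable 2 (\<lambda>xs. xs ! 0 div xs ! 1)" by (simp only:)
qed

lemma computable_mod:
  assumes "computable k f" "computable k g"
  shows "computable k (\<lambda>xs. f xs mod g xs)"
proof -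
  have "computable k (\<lambda>xs. f xs - f xs div g xs * g xs)"
    using assms by (intro computable_diff computable_mult computable_div)
  then show ?thesis by (simp add: minus_div_mult_eq_mod)
qed

section \<open>Decoding pairs and lists\<close>

lemma prod_decode_least:
  defines "s \<equiv> \<lambda>m. LEAST y. Suc m - triangle (Suc y) = 0"
  shows "prod_decode m = (m - triangle (s m), s m - (m - triangle (s m)))"
proof -
  obtain a b where ab: "prod_decode m = (a, b)" by force
  then have m: "m = triangle (a + b) + a"
    using prod_decode_inverse[of m] by (simp add: prod_encode_def)
  \<comment> \<open>The pairs with sum y have the codes from \<open>triangle y\<close> up to but
    excluding \<open>triangle (Suc y)\<close>; the search finds the first y whose block ends beyond
    \<open>m\<close>.\<close>
  have "s m = a + b" unfolding s_def
  proof (rule Least_equality)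
    show "Suc m - triangle (Suc (a + b)) = 0" by (simp add: m)
    show "a + b \<le> y" if "Suc m - triangle (Suc y) = 0" for y
    proof (rule ccontr)
      assume "\<not> a + b \<le> y"
      then have "triangle (Suc y) \<le> triangle (a + b)"
        unfolding triangle_def by (intro div_le_mono mult_le_mono) auto
      then show False using that m by simp
    qed
  qed
  then show ?thesis using ab m by simp
qed

lemma computable_triangle: "computable k f \<Longrightarrow> computable k (\<lambda>xs. triangle (f xs))"
  unfolding triangle_def by (intro computable_div computable_mult computable_Suc computable_const)

lemma computable_prod_decode:
  assumes "computable k f"
  shows "computable k (\<lambda>xs. fst (prod_decode (f xs)))" "computable k (\<lambda>xs. snd (prod_decode (f xs)))"
proof -
  have "computable 1 (\<lambda>xs. LEAST y. Suc (xs ! 0) - triangle (Suc y) = 0)"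
  proof (rule computable_least)
    show "computable (Suc 1) (\<lambda>ys. Suc (tl ys ! 0) - triangle (Suc (hd ys)))"
    proof (rule computable_cong)
      show "computable (Suc 1) (\<lambda>ys. Suc (ys ! 1) - triangle (Suc (ys ! 0)))"
        by (intro computable_diff computable_Suc computable_triangle computable_nth) simp_all
      show "Suc (ys ! 1) - triangle (Suc (ys ! 0)) = Suc (tl ys ! 0) - triangle (Suc (hd ys))"
        if "length ys = Suc 1" for ys :: "nat list"
        using that by (cases ys) auto
    qed
    show "\<exists>y. Suc (xs ! 0) - triangle (Suc y) = 0" for xs :: "nat list"
      by (rule exI[of _ "xs ! 0"]) simp
  qed
  from computable_comp1[OF this assms]
  have s: "computable k (\<lambda>xs. LEAST y. Suc (f xs) - triangle (Suc y) = 0)" .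
  show "computable k (\<lambda>xs. fst (prod_decode (f xs)))"
    unfolding prod_decode_least fst_conv
    by (intro computable_diff computable_triangle s assms)
  show "computable k (\<lambda>xs. snd (prod_decode (f xs)))"
    unfolding prod_decode_least snd_conv
    by (intro computable_diff computable_triangle s assms)
qed

lemmas computable_intros = computable_add computable_mult computable_power computable_diff
  computable_if_0 computable_if_less computable_if_eq computable_div computable_mod
  computable_Suc computable_nth computable_drop_nth computable_const computable_prod_decode

text \<open>The code of a nonempty list is the successor of a pair code, hence the subtraction of 1.
  The empty list has code 0, which decodes to (0, 0), so tails beyond the end remain 0.\<close>

definition tail_code :: "nat \<Rightarrow> nat \<Rightarrow> nat" where
  "tail_code c i = rec_nat c (\<lambda>_ r. snd (prod_decode (r - 1))) i"

definition head_code :: "nat \<Rightarrow> nat" where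
  "head_code c = fst (prod_decode (c - 1))"

lemma tail_code_list_encode: "tail_code (list_encode xs) i = list_encode (drop i xs)"
proof (induction i)
  case (Suc i)
  have "snd (prod_decode (list_encode ys - 1)) = list_encode (tl ys)" for ys
  proof (cases ys)
    case Nil
    have "prod_encode (0, 0) = 0" by (simp add: prod_encode_def)
    then have "prod_decode 0 = (0, 0)" by (metis prod_encode_inverse)
    then show ?thesis using Nil by simp
  qed simp
  then show ?case using Suc by (simp add: tail_code_def drop_Suc tl_drop)
qed (simp add: tail_code_def)

lemma head_code_list_encode: "head_code (list_encode (x # xs)) = x"
  by (simp add: head_code_def)

text \<open>Makes the sum of two word codes a common bound for both lengths.\<close>

lemma length_le_list_encode: "length xs \<le> list_encode xs"
proof (induction xs)
  case (Cons x xs)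
  then show ?case using le_prod_encode_2[of "list_encode xs" x] by simp
qed simp

lemma computable_tail_code:
  "computable k f \<Longrightarrow> computable k g \<Longrightarrow> computable k (\<lambda>xs. tail_code (f xs) (g xs))"
  unfolding tail_code_def by (rule computable_rec) (auto intro!: computable_intros)

lemma computable_head_code: "computable k f \<Longrightarrow> computable k (\<lambda>xs. head_code (f xs))"
  unfolding head_code_def by (intro computable_intros)

section \<open>Simulation in the natural numbers\<close>

text \<open>
  After \<open>j\<close> letters a real \<open>x\<close> is represented by the natural number \<open>(x + j(2n + 2)) (2n + 1)\<^sup>j\<close>.
  The scaling clears the denominators. The shift by a period of the action per letter keeps the
  numbers nonnegative, and it turns the translations by negative amounts into additions.
\<close>

definition half_turn_nat :: "nat \<Rightarrow> nat \<Rightarrow> nat \<Rightarrow> nat" where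
  "half_turn_nat n U X =
     X div ((2 * n + 2) * U) * (2 * n + 2) * (2 * n + 1) * U +
     (if X mod ((2 * n + 2) * U) < (2 * n + 1) * U
      then (2 * n + 1) * (2 * n + 1) * U + X mod ((2 * n + 2) * U)
      else (2 * n + 2) * (2 * n + 1) * U +
        (2 * n + 1) * (2 * n + 1) * (X mod ((2 * n + 2) * U) - (2 * n + 1) * U))"

text \<open>The result has scale (2n + 1) U and includes a shift by one period: 2n + 4 is the period
  plus 2, 2n is the period minus 2, and for b and its inverse the final subtractions of 2n and 2n +
  2 become additions of 2 and 0.\<close>

definition step_nat :: "nat \<Rightarrow> nat \<Rightarrow> nat \<Rightarrow> nat \<Rightarrow> nat" where
  "step_nat n U l X =
     (if l = 0 then (2 * n + 1) * (X + (2 * n + 4) * U)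
      else if l = 1 then half_turn_nat n U X + 2 * (2 * n + 1) * U
      else if l = 2 then (2 * n + 1) * (X + 2 * n * U)
      else half_turn_nat n U (X + 2 * n * U))"

text \<open>
  The word with code \<open>c\<close> is read from right to left as if it had length \<open>L\<close>; missing letters are
  treated as letters that act trivially. The clamp (none, minimum or maximum) is applied to
  the representative of \<open>0\<close> and the new value.
\<close>

definition run_nat :: "nat \<Rightarrow> (nat \<Rightarrow> nat \<Rightarrow> nat) \<Rightarrow> nat \<Rightarrow> nat \<Rightarrow> nat \<Rightarrow> nat" where
  "run_nat n clamp c L j = rec_nat 0 (\<lambda>j X. clamp (Suc j * (2 * n + 2) * (2 * n + 1) ^ Suc j)
     (if tail_code c (L - 1 - j) = 0 then (2 * n + 1) * (X + (2 * n + 2) * (2 * n + 1) ^ j)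
      else step_nat n ((2 * n + 1) ^ j) (head_code (tail_code c (L - 1 - j))) X)) j"

section \<open>Correctness of the simulation\<close>

lemma half_turn_nat:
  assumes "U > 0"
  shows "real (half_turn_nat n U X) / real ((2 * n + 1) * U) = half_turn n (real X / real U)"
proof -
  define T D where "T = 2 * n + 2" and "D = 2 * n + 1"
  \<comment> \<open>Euclidean division by T U splits X / U into whole periods and a
    remainder.\<close>
  define q R where "q = X div (T * U)" and "R = X mod (T * U)"
  have pos: "D > 0" "T > 0" by (simp_all add: T_def D_def)
  have X: "X = q * (T * U) + R" by (simp only: q_def R_def div_mult_mod_eq)
  have R: "R < T * U" using assms pos by (simp add: R_def)
  have Xr: "real X / real U = of_int (int q) * (2 * real n + 2) + real R / real U"
    using assms by (simp add: X T_def field_simps)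
  have less: "real R / real U < real k \<longleftrightarrow> R < k * U" for k
    using assms by (simp add: pos_divide_less_eq flip: of_nat_mult)
  have h: "half_turn n (real X / real U) = of_int (int q) * (2 * real n + 2) +
      (if real R / real U < 2 * real n + 1 then 2 * real n + 1 + real R / real U / (2 * real n + 1)
       else 2 * real n + 2 + (2 * real n + 1) * (real R / real U - (2 * real n + 1)))"
    unfolding Xr by (rule half_turn_eq) (use R less[of T] in \<open>simp_all add: T_def add.commute\<close>)
  have hn: "half_turn_nat n U X = q * T * D * U +
      (if R < D * U then D * D * U + R else T * D * U + D * D * (R - D * U))"
    by (simp add: half_turn_nat_def T_def D_def q_def R_def)
  have Dr: "2 * real n + 1 = real D" "2 * real n + 2 = real T" by (simp_all add: D_def T_def)
  have "real (half_turn_nat n U X) / real (D * U) = half_turn n (real X / real U)"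
    unfolding hn h Dr less using pos assms by (auto simp: field_simps)
  then show ?thesis by (simp only: D_def)
qed

text \<open>Every letter commutes with the translation by a period, so the shifts of earlier letters
  pass through the next one.\<close>

lemma lact_shift: "lact n l (x + real k * (2 * real n + 2)) = lact n l x + real k * (2 * real n + 2)"
proof (induction k)
  case (Suc k)
  have *: "lact n l (y + (2 * real n + 2)) = lact n l y + (2 * real n + 2)" for y
    using half_turn_shift[of n y] half_turn_shift[of n "y + 2 * real n"]
    by (cases "(n, l, y)" rule: lact.cases) (simp_all add: add.assoc add.left_commute add.commute)
  have "lact n l (x + real (Suc k) * (2 * real n + 2)) =
      lact n l (x + real k * (2 * real n + 2) + (2 * real n + 2))"
    by (simp add: algebra_simps)
  also have "\<dots> = lact n l x + real k * (2 * real n + 2) + (2 * real n + 2)"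
    by (simp only: * Suc)
  finally show ?case by (simp add: algebra_simps)
qed simp

lemma step_nat:
  assumes "U > 0"
  shows "real (step_nat n U (letter_code l) X) / real ((2 * n + 1) * U) =
    lact n l (real X / real U) + (2 * real n + 2)"
proof -
  have scale: "real ((2 * n + 1) * Y) / real ((2 * n + 1) * U) = real Y / real U" for Y
    by (simp only: of_nat_mult, rule mult_divide_mult_cancel_left) simp
  have shift: "real (X + 2 * n * U) / real U = real X / real U + 2 * real n"
    using assms by (simp add: field_simps)
  show ?thesis
  proof (cases "(n, l, real X / real U)" rule: lact.cases)
    case (1 n' x)
    have "real (X + (2 * n + 4) * U) / real U = real X / real U + (2 * real n + 4)"
      using assms by (simp add: field_simps)
    then show ?thesis using 1 scale[of "X + (2 * n + 4) * U"] by (simp add: step_nat_def)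
  next
    case (2 n' x)
    then show ?thesis using scale[of "X + 2 * n * U"] shift by (simp add: step_nat_def)
  next
    case (3 n' x)
    have "real (2 * (2 * n + 1) * U) = 2 * real ((2 * n + 1) * U)" by simp
    moreover have "real ((2 * n + 1) * U) \<noteq> 0" using assms by (simp only: of_nat_eq_0_iff) simp
    ultimately have "real (2 * (2 * n + 1) * U) / real ((2 * n + 1) * U) = 2"
      by (metis nonzero_mult_div_cancel_right)
    then show ?thesis using 3 half_turn_nat[OF assms, of n X]
      by (simp add: step_nat_def add_divide_distrib)
  next
    case (4 n' x)
    then show ?thesis using half_turn_nat[OF assms, of n "X + 2 * n * U"] shift
      by (simp add: step_nat_def)
  qed
qed

text \<open>\<open>h\<close> is the real counterpart of \<open>clamp\<close>. Missing letters lie at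
  the right end, so they are read first and keep the value at 0, as \<open>h 0 = 0\<close>; only
  scale and shift grow.\<close>

lemma run_nat:
  assumes clamp: "\<And>b Y S. S > 0 \<Longrightarrow> real (clamp (b * S) Y) / real S = h (real Y / real S - real b) + real b"
    and h: "h 0 = 0" and j: "j \<le> L" and L: "length w \<le> L"
  shows "real (run_nat n clamp (word_code w) L j) / real ((2 * n + 1) ^ j) =
    foldr (\<lambda>l x. h (lact n l x)) (drop (L - j) w) 0 + real (j * (2 * n + 2))"
  using j
proof (induction j)
  case 0
  then show ?case using L by (simp add: run_nat_def)
next
  case (Suc j)
  define U where "U = (2 * n + 1) ^ j"
  define X where "X = run_nat n clamp (word_code w) L j"
  define x where "x = foldr (\<lambda>l x. h (lact n l x)) (drop (L - j) w) 0"
  \<comment> \<open>Reading starts from the right, so step \<open>j\<close>, counted from 0, meets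
    position \<open>L - 1 - j\<close>.\<close>
  define i where "i = L - 1 - j"
  define Y where "Y = (if tail_code (word_code w) i = 0 then (2 * n + 1) * (X + (2 * n + 2) * U)
      else step_nat n U (head_code (tail_code (word_code w) i)) X)"
  have i: "L - j = Suc i" "L - Suc j = i" using Suc.prems by (simp_all add: i_def)
  have U: "U > 0" by (simp add: U_def)
  have IH: "real X / real U = x + real j * (2 * real n + 2)"
    using Suc by (simp add: X_def U_def x_def algebra_simps)
  have tail: "tail_code (word_code w) i = list_encode (map letter_code (drop i w))"
    by (simp add: word_code_def tail_code_list_encode drop_map)
  have run: "run_nat n clamp (word_code w) L (Suc j) = clamp (Suc j * (2 * n + 2) * ((2 * n + 1) * U)) Y"
    by (simp add: run_nat_def Y_def X_def U_def i_def)
  have fold: "real (run_nat n clamp (word_code w) L (Suc j)) / real ((2 * n + 1) ^ Suc j) =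
      h (real Y / real ((2 * n + 1) * U) - real (Suc j * (2 * n + 2))) + real (Suc j * (2 * n + 2))"
    using clamp[of "(2 * n + 1) * U" "Suc j * (2 * n + 2)" Y] U run by (simp only: U_def power_Suc) simp
  show ?case
  proof (cases "drop i w")
    case Nil
    then have "drop (L - j) w = []" by (simp add: i)
    then have "x = 0" by (simp add: x_def)
    have "Y = (2 * n + 1) * (X + (2 * n + 2) * U)" using tail Nil by (simp add: Y_def)
    then have "real Y / real ((2 * n + 1) * U) = real (X + (2 * n + 2) * U) / real U"
      by (simp only: of_nat_mult, intro mult_divide_mult_cancel_left) simp
    also have "\<dots> = real (Suc j * (2 * n + 2))"
      using IH U \<open>x = 0\<close> by (simp add: add_divide_distrib algebra_simps)
    finally show ?thesis using fold Nil h i by simp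
  next
    case (Cons l v)
    then have v: "drop (L - j) w = v" by (metis i(1) drop_Suc tl_drop list.sel(3))
    have "tail_code (word_code w) i \<noteq> 0" using tail Cons by simp
    then have "Y = step_nat n U (letter_code l) X"
      using tail Cons head_code_list_encode[of "letter_code l" "map letter_code v"] by (simp add: Y_def)
    then have "real Y / real ((2 * n + 1) * U) = lact n l (x + real j * (2 * real n + 2)) + (2 * real n + 2)"
      using step_nat[OF U, of n l X] IH by simp
    also have "\<dots> = lact n l x + real (Suc j * (2 * n + 2))"
      by (simp only: lact_shift) (simp add: algebra_simps)
    finally show ?thesis using fold Cons i v by (simp add: x_def)
  qed
qed

text \<open>The common padded length \<open>L\<close> gives both runs the same scale and shift, so
  comparing the natural numbers compares the reals.\<close>

lemma run_nat_eq_iff: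
  assumes clamp: "\<And>b Y S. S > 0 \<Longrightarrow> real (clamp (b * S) Y) / real S = h (real Y / real S - real b) + real b"
    and h: "h 0 = 0" and L: "length u \<le> L" "length v \<le> L"
  shows "run_nat n clamp (word_code u) L L = run_nat n clamp (word_code v) L L \<longleftrightarrow>
    foldr (\<lambda>l x. h (lact n l x)) u 0 = foldr (\<lambda>l x. h (lact n l x)) v 0"
proof -
  have "run_nat n clamp (word_code u) L L = run_nat n clamp (word_code v) L L \<longleftrightarrow>
    real (run_nat n clamp (word_code u) L L) / real ((2 * n + 1) ^ L) =
    real (run_nat n clamp (word_code v) L L) / real ((2 * n + 1) ^ L)" by simp
  also have "\<dots> \<longleftrightarrow> foldr (\<lambda>l x. h (lact n l x)) u 0 = foldr (\<lambda>l x. h (lact n l x)) v 0"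
    using run_nat[of clamp h L L u n, OF clamp h order_refl L(1)]
      run_nat[of clamp h L L v n, OF clamp h order_refl L(2)] by (simp only: add_right_cancel) simp
  finally show ?thesis .
qed

lemma congruent_iff_run_nat:
  assumes L: "length u \<le> L" "length v \<le> L"
  shows "elem n u = elem n v \<longleftrightarrow>
    run_nat n (\<lambda>b Y. Y) (word_code u) L L = run_nat n (\<lambda>b Y. Y) (word_code v) L L \<and>
    run_nat n min (word_code u) L L = run_nat n min (word_code v) L L \<and>
    run_nat n max (word_code u) L L = run_nat n max (word_code v) L L"
proof -
  have "wact n u 0 = wact n v 0 \<longleftrightarrow>
      run_nat n (\<lambda>b Y. Y) (word_code u) L L = run_nat n (\<lambda>b Y. Y) (word_code v) L L"
    using run_nat_eq_iff[of "\<lambda>b Y. Y" "\<lambda>x. x", OF _ _ L] by (simp add: wact_def)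
  moreover have "low n u = low n v \<longleftrightarrow>
      run_nat n min (word_code u) L L = run_nat n min (word_code v) L L"
    unfolding low_def
    by (rule run_nat_eq_iff[symmetric, OF _ _ L]) (auto simp: min_def field_simps simp flip: of_nat_mult)
  moreover have "high n u = high n v \<longleftrightarrow>
      run_nat n max (word_code u) L L = run_nat n max (word_code v) L L"
    unfolding high_def
    by (rule run_nat_eq_iff[symmetric, OF _ _ L]) (auto simp: max_def field_simps simp flip: of_nat_mult)
  ultimately show ?thesis by (simp add: congruent_iff)
qed

section \<open>Computability of the simulation\<close>

lemma computable_half_turn_nat:
  "computable k f \<Longrightarrow> computable k g \<Longrightarrow> computable k (\<lambda>xs. half_turn_nat n (f xs) (g xs))"
  unfolding half_turn_nat_def by (intro computable_intros)

lemma computable_step_nat: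
  "computable k f \<Longrightarrow> computable k g \<Longrightarrow> computable k h \<Longrightarrow>
    computable k (\<lambda>xs. step_nat n (f xs) (g xs) (h xs))"
  unfolding step_nat_def by (intro computable_intros computable_half_turn_nat)

lemma computable_run_nat:
  assumes clamp: "\<And>k f g. computable k f \<Longrightarrow> computable k g \<Longrightarrow> computable k (\<lambda>xs. clamp (f xs) (g xs))"
    and i: "i < 2"
  shows "computable 2 (\<lambda>xs. run_nat n clamp (xs ! i) (xs ! 0 + xs ! 1) (xs ! 0 + xs ! 1))"
  unfolding run_nat_def
  by (rule computable_rec)
    (use i in \<open>auto intro!: computable_intros computable_tail_code computable_head_code
      computable_step_nat clamp\<close>)

theorem theorem1p6:
  fixes n :: nat
  assumes "n \<ge> 1"
  shows "word_problem_decidable {([Gen_a], [Gen_b] @ replicate n Gen_a @ [Gen_b])}"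
proof -
  let ?run = "\<lambda>clamp i (xs :: nat list). run_nat n clamp (xs ! i) (xs ! 0 + xs ! 1) (xs ! 0 + xs ! 1)"
  \<comment> \<open>The nested conditionals form the conjunction of the three comparisons in
    \<open>congruent_iff_run_nat\<close>.\<close>
  let ?f = "\<lambda>xs. if ?run (\<lambda>b Y. Y) 0 xs = ?run (\<lambda>b Y. Y) 1 xs
    then if ?run min 0 xs = ?run min 1 xs
      then if ?run max 0 xs = ?run max 1 xs then 1 else 0 else 0 else 0"
  have min: "computable k (\<lambda>xs. min (f xs) (g xs))" if "computable k f" "computable k g" for k f g
    by (rule computable_cong[OF computable_if_less[OF that that]]) simp
  have max: "computable k (\<lambda>xs. max (f xs) (g xs))" if "computable k f" "computable k g" for k f g
    by (rule computable_cong[OF computable_if_less[OF that that(2,1)]]) simp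
  have "computable 2 ?f"
    by (intro computable_if_eq computable_const computable_run_nat min max) simp_all
  then obtain f where f: "recursive_fun 2 f" "\<forall>xs. length xs = 2 \<longrightarrow> f xs = ?f xs"
    unfolding computable_def by blast
  have "f [word_code u, word_code v] = (if elem n u = elem n v then 1 else 0)" for u v
  proof -
    have "length u \<le> word_code u + word_code v" "length v \<le> word_code u + word_code v"
      using length_le_list_encode[of "map letter_code u"] length_le_list_encode[of "map letter_code v"]
      by (simp_all add: word_code_def)
    from congruent_iff_run_nat[OF this] show ?thesis using f(2) by simp
  qed
  then show ?thesis
    using f(1) unfolding word_problem_decidable_def decidable_def relations_def by blast
qed

end
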